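(* For every fixed integer $d\ge 2$ and every fixed $q\in[0.9999998,\,1)$, the function $p\mapsto \mathbf P(\mathrm{FM}(d,q,p)\text{ is recurrent})$, $p\in[0,1]$, is not monotone in $p$, where $\mathrm{FM}(d,q,p)$ is the frog model with death $1-q$ and drift $p$ on the $d$-ary tree.
   Context: Let $\mathbb T_d$ be the infinite rooted $d$-ary tree (every vertex, including the root, has exactly $d$ children). The frog model with death $1-q$ and drift $p$, denoted $\mathrm{FM}(d,q,p)$, is the following discrete-time process. Initially there is one active frog at the root and one sleeping frog at each non-root vertex. Before taking each step, each active frog independently dies (and is removed) with probability $1-q$; with probability $q$ it survives and jumps. A surviving active frog at a non-root vertex moves to the parent of its current vertex with probability $p$ and with probability $1-p$ moves to a uniformly chosen child of its current vertex. A surviving active frog at the root stays in place with probability $p$ and with probability $1-p$ moves to a uniformly chosen child of the root. All choices are independent across frogs and steps. Whenever an active frog visits a vertex containing a sleeping frog, that sleeping frog becomes active and from then on follows the same rules independently. A realization of the process is called recurrent if the root is visited by infinitely many active frogs, and transient otherwise. *)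

theory Defs
  imports "HOL-Probability.Probability"
begin

text \<open>
  A vertex of the \<open>d\<close>-ary tree is the list of child indices leading to it, the most recent index
  first: the root is \<open>[]\<close>, the children of \<open>x\<close> are \<open>i # x\<close> with \<open>i < d\<close>, and the parent of a
  non-root vertex \<open>x\<close> is \<open>tl x\<close>.
\<close>

type_synonym vertex = "nat list"

definition tree :: "nat \<Rightarrow> vertex set" where
  "tree d = lists {..<d}"

datatype action = Die | Up | Down nat

text \<open>One draw covers both the death coin tossed before a step and the step itself.\<close>

definition action_pmf :: "nat \<Rightarrow> real \<Rightarrow> real \<Rightarrow> action pmf" where
  "action_pmf d q p =
     bernoulli_pmf q \<bind> (\<lambda>survive.
       if \<not> survive then return_pmf Die
       else bernoulli_pmf p \<bind> (\<lambda>up.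
         if up then return_pmf Up else map_pmf Down (pmf_of_set {..<d})))"

text \<open>
  There is exactly one frog per vertex, so frogs are named by their initial vertices.
  \<open>Active x k\<close> is an active frog at \<open>x\<close> that has made \<open>k\<close> steps since it became active.
\<close>

datatype status = Asleep | Active vertex nat | Dead

text \<open>
  \<open>advance A s\<close> is one time step of a frog in status \<open>s\<close> whose successive actions after activation
  are \<open>A 0, A 1, \<dots>\<close>. Since \<open>tl [] = []\<close>, the action \<open>Up\<close> leaves a frog at the root in place.
\<close>

fun advance :: "(nat \<Rightarrow> action) \<Rightarrow> status \<Rightarrow> status" where
  "advance A Asleep = Asleep"
| "advance A Dead = Dead"
| "advance A (Active x k) =
     (case A k of
        Die \<Rightarrow> Dead
      | Up \<Rightarrow> Active (tl x) (Suc k)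
      | Down i \<Rightarrow> Active (i # x) (Suc k))"

text \<open>
  \<open>config d \<omega> t v\<close> is the status at time \<open>t\<close> of the frog started at \<open>v\<close>, where \<open>\<omega> (v, k)\<close> is the
  \<open>k\<close>-th action of that frog after its activation. A sleeping frog becomes active at the time
  at which some active frog arrives at its vertex, and makes its own first step one time unit later.
\<close>

fun config :: "nat \<Rightarrow> (vertex \<times> nat \<Rightarrow> action) \<Rightarrow> nat \<Rightarrow> vertex \<Rightarrow> status" where
  "config d \<omega> 0 v = (if v = [] then Active [] 0 else Asleep)"
| "config d \<omega> (Suc t) v =
     (if config d \<omega> t v = Asleep \<and>
         (\<exists>w\<in>tree d. \<exists>k. advance (\<lambda>j. \<omega> (w, j)) (config d \<omega> t w) = Active v k)
      then Active v 0
      else advance (\<lambda>j. \<omega> (v, j)) (config d \<omega> t v))"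

definition recurrent :: "nat \<Rightarrow> (vertex \<times> nat \<Rightarrow> action) \<Rightarrow> bool" where
  "recurrent d \<omega> \<longleftrightarrow> infinite {v \<in> tree d. \<exists>t k. config d \<omega> t v = Active [] k}"

definition FM :: "nat \<Rightarrow> real \<Rightarrow> real \<Rightarrow> (vertex \<times> nat \<Rightarrow> action) measure" where
  "FM d q p = (\<Pi>\<^sub>M i \<in> tree d \<times> UNIV. measure_pmf (action_pmf d q p))"

definition recurrence_prob :: "nat \<Rightarrow> real \<Rightarrow> real \<Rightarrow> real" where
  "recurrence_prob d q p = measure (FM d q p) {\<omega> \<in> space (FM d q p). recurrent d \<omega>}"

text \<open>The recurrence event is measurable, so \<open>recurrence_prob\<close> is a genuine probability.\<close>

instance action :: countable by countable_datatype
instance status :: countable by countable_datatype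

lemma measurable_advance:
  assumes w: "w \<in> tree d" and c: "(\<lambda>\<omega>. config d \<omega> t w) \<in> measurable (FM d q p) (count_space UNIV)"
  shows "(\<lambda>\<omega>. advance (\<lambda>j. \<omega> (w, j)) (config d \<omega> t w)) \<in> measurable (FM d q p) (count_space UNIV)"
proof -
  have coord: "(\<lambda>\<omega>. \<omega> (w, j)) \<in> measurable (FM d q p) (count_space UNIV)" for j
  proof -
    have "(\<lambda>\<omega>. \<omega> (w, j)) \<in> measurable (FM d q p) (measure_pmf (action_pmf d q p))"
      unfolding FM_def by (rule measurable_component_singleton) (use w in auto)
    thus ?thesis by (simp cong: measurable_cong_sets)
  qed
  have "(\<lambda>\<omega>. advance (\<lambda>j. \<omega> (w, j)) s) \<in> measurable (FM d q p) (count_space UNIV)" for s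
  proof (cases s)
    case (Active x k)
    show ?thesis unfolding Active advance.simps
      by (rule measurable_compose[OF coord]) simp
  qed auto
  from measurable_compose_countable[OF this c] show ?thesis .
qed

lemma measurable_config:
  "v \<in> tree d \<Longrightarrow> (\<lambda>\<omega>. config d \<omega> t v) \<in> measurable (FM d q p) (count_space UNIV)"
proof (induction t arbitrary: v)
  case 0 thus ?case by simp
next
  case (Suc t)
  note A = measurable_advance[OF _ Suc.IH]
  have P: "Measurable.pred (FM d q p) (\<lambda>\<omega>. config d \<omega> t v = Asleep \<and>
         (\<exists>w\<in>tree d. \<exists>k. advance (\<lambda>j. \<omega> (w, j)) (config d \<omega> t w) = Active v k))"
  proof (intro pred_intros_logic pred_intros_countable_bounded pred_intros_countable)
    show "Measurable.pred (FM d q p) (\<lambda>\<omega>. config d \<omega> t v = Asleep)"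
      by (rule measurable_compose[OF Suc.IH[OF Suc.prems]]) simp
    show "Measurable.pred (FM d q p) (\<lambda>\<omega>. advance (\<lambda>j. \<omega> (w, j)) (config d \<omega> t w) = Active v k)" if "w \<in> tree d" for w k
      by (rule measurable_compose[OF A[OF that that]]) simp
  qed
  show ?case unfolding config.simps
    by (rule measurable_If[OF _ _ P[unfolded pred_def]]) (use A[OF Suc.prems Suc.prems] in auto)
qed

lemma sets_recurrent: "{\<omega> \<in> space (FM d q p). recurrent d \<omega>} \<in> sets (FM d q p)"
proof -
  have rec: "recurrent d \<omega> \<longleftrightarrow>
      (\<forall>n. \<exists>v\<in>{v \<in> tree d. n \<le> to_nat v}. \<exists>t k. config d \<omega> t v = Active [] k)" for \<omega>
  proof -
    let ?S = "{v \<in> tree d. \<exists>t k. config d \<omega> t v = Active [] k}"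
    have "infinite ?S \<longleftrightarrow> infinite (to_nat ` ?S)"
      using finite_imageD[of to_nat ?S] by (auto intro: inj_on_subset[OF inj_to_nat])
    also have "\<dots> \<longleftrightarrow> (\<forall>n. \<exists>v\<in>?S. n \<le> to_nat v)"
      unfolding infinite_nat_iff_unbounded_le by (simp only: bex_simps image_iff) blast
    finally show ?thesis unfolding recurrent_def by blast
  qed
  have conf: "Measurable.pred (FM d q p) (\<lambda>\<omega>. config d \<omega> t v = Active [] k)"
    if "v \<in> tree d" for v t k
    by (rule measurable_compose[OF measurable_config[OF that]]) simp
  have "Measurable.pred (FM d q p) (\<lambda>\<omega>. recurrent d \<omega>)"
    unfolding rec by (intro pred_intros_countable_bounded pred_intros_countable conf) auto
  thus ?thesis by (simp add: pred_def)
qed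

end

theory Submission
  imports Defs
begin

text \<open>
  For \<open>p = 0\<close> no frog ever moves up and for \<open>p = 1\<close> no frog ever moves down, so in both cases only
  the initial frog visits the root. It remains to find recurrence with positive probability for
  some \<open>p\<close> in between, and \<open>p = 1/2\<close> works.

  Which frogs wake up does not depend on the timing: a frog wakes up iff it is reachable from the
  root in the random digraph with an edge from \<open>v\<close> to every vertex hit by the frog of \<open>v\<close>. Let \<open>r\<close> and
  \<open>y\<close> be the infimal probabilities that a frog ever hits the parent and a given child of its current
  vertex. First-step analysis gives quadratic inequalities which, for \<open>p = 1/2\<close> and \<open>q\<close> near \<open>1\<close>,
  force \<open>r\<close> to be near \<open>1\<close> and \<open>d y\<close> to be at least nearly \<open>1\<close>. A grandchild \<open>w\<close> of \<open>v\<close> is hit by the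
  frog of \<open>v\<close>, or by the frog of the parent of \<open>w\<close> after that one was woken by the frog of \<open>v\<close>, with
  probability at least \<open>y\<^sup>2 (2 - y)\<close>. Hence the woken vertices on even levels dominate a branching
  process with mean at least \<open>m = d\<^sup>2 y\<^sup>2 (2 - y)\<close>, about \<open>2 - 1/d\<close>. A frog at level \<open>2n\<close> hits the root
  with probability at least \<open>r\<^bsup>2n\<^esup>\<close>. As \<open>m r\<^sup>2 > 1\<close>, the probability that some frog of level \<open>2n\<close> is
  woken and hits the root is bounded below uniformly in \<open>n\<close>, and with at least this probability it
  happens for infinitely many \<open>n\<close>.
\<close>

subsection \<open>Activation along hit vertices\<close>

text \<open>\<open>k\<close> is the number of actions the frog has already used up.\<close>

fun hits_within :: "nat \<Rightarrow> (nat \<Rightarrow> action) \<Rightarrow> nat \<Rightarrow> vertex \<Rightarrow> vertex \<Rightarrow> bool" where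
  "hits_within 0 A k u x \<longleftrightarrow> u = x"
| "hits_within (Suc T) A k u x \<longleftrightarrow> u = x \<or>
     (case A k of
        Die \<Rightarrow> False
      | Up \<Rightarrow> hits_within T A (Suc k) (tl u) x
      | Down i \<Rightarrow> hits_within T A (Suc k) (i # u) x)"

definition frog_hits :: "(vertex \<times> nat \<Rightarrow> action) \<Rightarrow> vertex \<Rightarrow> vertex \<Rightarrow> bool" where
  "frog_hits \<omega> v x \<longleftrightarrow> (\<exists>T. hits_within T (\<lambda>j. \<omega> (v, j)) 0 v x)"

definition activated :: "nat \<Rightarrow> (vertex \<times> nat \<Rightarrow> action) \<Rightarrow> vertex \<Rightarrow> bool" where
  "activated d \<omega> v \<longleftrightarrow> (\<exists>t. config d \<omega> t v = Active v 0)"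

text \<open>Once active, a frog follows its own action sequence regardless of all others, so its
  free path is its path in \<open>config\<close>. The last conjunct exposes the arrival as an
  \<open>advance\<close> step, the form in which \<open>config\<close> detects the waking of a
  sleeping frog.\<close>

lemma config_hits_within:
  assumes "hits_within T (\<lambda>j. \<omega> (v, j)) k u x" and "config d \<omega> t v = Active u k"
  shows "\<exists>t' k'. config d \<omega> t' v = Active x k' \<and> (u \<noteq> x \<longrightarrow> (\<exists>s k''. t' = Suc s \<and>
    advance (\<lambda>j. \<omega> (v, j)) (config d \<omega> s v) = Active x k''))"
  using assms
proof (induction T arbitrary: k u t)
  case (Suc T)
  show ?case
  proof (cases "u = x")
    case False
    define u' where "u' = (case \<omega> (v, k) of Down i \<Rightarrow> i # u | _ \<Rightarrow> tl u)"
    from Suc.prems False have hit: "hits_within T (\<lambda>j. \<omega> (v, j)) (Suc k) u' x"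
      and adv: "advance (\<lambda>j. \<omega> (v, j)) (config d \<omega> t v) = Active u' (Suc k)"
      by (auto simp: u'_def split: action.splits)
    have conf: "config d \<omega> (Suc t) v = Active u' (Suc k)" using adv Suc.prems(2) by simp
    show ?thesis
    proof (cases "u' = x")
      case True
      with conf adv show ?thesis by blast
    next
      case False
      with Suc.IH[OF hit conf] show ?thesis by blast
    qed
  qed (use Suc.prems in auto)
qed auto

lemma activated_if_awake:
  "config d \<omega> t v \<noteq> Asleep \<Longrightarrow> activated d \<omega> v"
proof (induction t)
  case 0
  thus ?case unfolding activated_def by (intro exI[of _ 0]) (auto split: if_splits)
next
  case (Suc t)
  show ?case
  proof (cases "config d \<omega> t v = Asleep")
    case True
    with Suc.prems have "config d \<omega> (Suc t) v = Active v 0" by (auto split: if_splits)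
    thus ?thesis unfolding activated_def by blast
  qed (rule Suc.IH)
qed

text \<open>This makes waking a reachability question free of timing: when the frog of
  \<open>v\<close> arrives at \<open>x\<close>, the frog of \<open>x\<close> is either awake already
  or is woken by this arrival, and no awake frog falls asleep again.\<close>

lemma activated_frog_hits:
  assumes "activated d \<omega> v" "v \<in> tree d" "frog_hits \<omega> v x"
  shows "activated d \<omega> x"
proof (cases "v = x")
  case False
  from assms obtain t T where "config d \<omega> t v = Active v 0" "hits_within T (\<lambda>j. \<omega> (v, j)) 0 v x"
    by (auto simp: activated_def frog_hits_def)
  with config_hits_within False obtain s k
    where "advance (\<lambda>j. \<omega> (v, j)) (config d \<omega> s v) = Active x k" by blast
  with \<open>v \<in> tree d\<close> have "config d \<omega> (Suc s) x \<noteq> Asleep"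
    by (cases "config d \<omega> s x") (auto split: action.splits)
  thus ?thesis by (rule activated_if_awake)
qed (use assms in auto)

lemma activated_frog_visits:
  assumes "activated d \<omega> v" "frog_hits \<omega> v x"
  shows "\<exists>t k. config d \<omega> t v = Active x k"
  using assms config_hits_within unfolding activated_def frog_hits_def by blast

subsection \<open>Independence of disjoint sets of actions\<close>

text \<open>The coordinates of a product measure are independent, hence so are groups of them over
  disjoint index sets. Locality is expressed by \<open>det\<close> on the full space, so events need
  not be rewritten as events on subproducts.\<close>

lemma prob_PiM_disjoint:
  fixes N :: "'i \<Rightarrow> 'a measure"
  assumes N: "\<And>i. prob_space (N i)" and I: "I \<noteq> {}" and K: "finite K"
    and J: "disjoint_family_on J K" "\<And>k. k \<in> K \<Longrightarrow> J k \<subseteq> I"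
    and P: "\<And>k. k \<in> K \<Longrightarrow> Measurable.pred (Pi\<^sub>M I N) (P k)"
    and det: "\<And>k \<omega> \<omega>'. k \<in> K \<Longrightarrow> (\<And>i. i \<in> J k \<Longrightarrow> \<omega> i = \<omega>' i) \<Longrightarrow> P k \<omega> = P k \<omega>'"
  shows "\<P>(\<omega> in Pi\<^sub>M I N. \<forall>k\<in>K. P k \<omega>) = (\<Prod>k\<in>K. \<P>(\<omega> in Pi\<^sub>M I N. P k \<omega>))"
proof (cases "K = {}")
  case True
  interpret prob_space "Pi\<^sub>M I N" by (rule prob_space_PiM) (rule N)
  from True show ?thesis by (simp add: prob_space)
next
  case False
  let ?M = "Pi\<^sub>M I N"
  interpret prob_space ?M by (rule prob_space_PiM) (rule N)
  \<comment> \<open>Points of the space are extensional, so \<open>restrict\<close> is the identity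
    there and the joint law of the coordinates is the product of their laws, which is the criterion
    for independence.\<close>
  have "distr ?M ?M (\<lambda>\<omega>. restrict \<omega> I) = distr ?M ?M (\<lambda>\<omega>. \<omega>)"
    by (rule distr_cong) (auto simp: space_PiM)
  moreover have "(\<Pi>\<^sub>M i\<in>I. distr ?M (N i) (\<lambda>\<omega>. \<omega> i)) = ?M"
    by (rule PiM_cong) (use N in \<open>auto simp: distr_PiM_component\<close>)
  ultimately have "indep_vars N (\<lambda>i \<omega>. \<omega> i) I"
    by (subst indep_vars_iff_distr_eq_PiM'[OF I]) (auto simp: distr_id)
  from indep_vars_restrict[OF this J(2) J(1)]
  have ind: "indep_vars (\<lambda>k. Pi\<^sub>M (J k) N) (\<lambda>k \<omega>. restrict \<omega> (J k)) K"
    by simp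
  define A where "A k = {\<eta> \<in> space (Pi\<^sub>M (J k) N). P k \<eta>}" for k
  obtain \<omega>0 where \<omega>0: "\<omega>0 \<in> space ?M" using not_empty by blast
  have A: "A k \<in> sets (Pi\<^sub>M (J k) N)" if k: "k \<in> K" for k
  proof -
    \<comment> \<open>Coordinates outside \<open>J k\<close> are filled in from a fixed point. By
      \<open>det\<close> the filling does not affect \<open>P k\<close>, so measurability passes
      from the full product to the subproduct.\<close>
    let ?e = "\<lambda>\<eta>. \<lambda>i\<in>I. if i \<in> J k then \<eta> i else \<omega>0 i"
    have "?e \<in> measurable (Pi\<^sub>M (J k) N) ?M"
    proof (rule measurable_restrict)
      fix i assume "i \<in> I"
      thus "(\<lambda>\<eta>. if i \<in> J k then \<eta> i else \<omega>0 i) \<in> measurable (Pi\<^sub>M (J k) N) (N i)"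
        using \<omega>0 by (cases "i \<in> J k") (auto simp: space_PiM PiE_def Pi_def)
    qed
    from measurable_compose[OF this P[OF k]]
    have "Measurable.pred (Pi\<^sub>M (J k) N) (\<lambda>\<eta>. P k (?e \<eta>))" .
    moreover have "P k (?e \<eta>) = P k \<eta>" for \<eta>
      using J(2)[OF k] by (intro det[OF k]) auto
    ultimately show ?thesis by (simp add: A_def pred_def)
  qed
  have ev: "(\<lambda>\<omega>. restrict \<omega> (J k)) -` A k \<inter> space ?M = {\<omega> \<in> space ?M. P k \<omega>}" if k: "k \<in> K" for k
  proof -
    have "P k (restrict \<omega> (J k)) = P k \<omega>" for \<omega> by (intro det[OF k]) auto
    thus ?thesis using J(2)[OF k] by (auto simp: A_def space_PiM PiE_def Pi_def)
  qed
  have "prob (\<Inter>k\<in>K. (\<lambda>\<omega>. restrict \<omega> (J k)) -` A k \<inter> space ?M) =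
      (\<Prod>k\<in>K. prob ((\<lambda>\<omega>. restrict \<omega> (J k)) -` A k \<inter> space ?M))"
    by (rule indep_varsD_finite[OF ind False K A])
  also have "(\<Inter>k\<in>K. (\<lambda>\<omega>. restrict \<omega> (J k)) -` A k \<inter> space ?M) = {\<omega> \<in> space ?M. \<forall>k\<in>K. P k \<omega>}"
    using False by (subst INF_cong[OF refl ev]) auto
  also have "(\<Prod>k\<in>K. prob ((\<lambda>\<omega>. restrict \<omega> (J k)) -` A k \<inter> space ?M)) =
      (\<Prod>k\<in>K. \<P>(\<omega> in ?M. P k \<omega>))"
    by (intro prod.cong arg_cong[where f = prob] refl ev)
  finally show ?thesis .
qed

section \<open>Law of single actions and measurability of hitting events\<close>

lemma prob_space_FM: "prob_space (FM d q p)"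
  unfolding FM_def by (rule prob_space_PiM) (rule prob_space_measure_pmf)

lemma measurable_FM_action:
  "v \<in> tree d \<Longrightarrow> (\<lambda>\<omega>. \<omega> (v, k)) \<in> measurable (FM d q p) (count_space UNIV)"
proof -
  assume "v \<in> tree d"
  hence "(\<lambda>\<omega>. \<omega> (v, k)) \<in> measurable (FM d q p) (measure_pmf (action_pmf d q p))"
    unfolding FM_def by (intro measurable_component_singleton) auto
  thus ?thesis by (simp cong: measurable_cong_sets)
qed

lemma prob_FM_action:
  assumes "v \<in> tree d"
  shows "\<P>(\<omega> in FM d q p. \<omega> (v, k) = a) = pmf (action_pmf d q p) a"
proof -
  have "distr (FM d q p) (measure_pmf (action_pmf d q p)) (\<lambda>\<omega>. \<omega> (v, k)) = measure_pmf (action_pmf d q p)"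
    unfolding FM_def by (rule distr_PiM_component) (use assms in \<open>auto intro: prob_space_measure_pmf\<close>)
  hence "pmf (action_pmf d q p) a =
      measure (distr (FM d q p) (measure_pmf (action_pmf d q p)) (\<lambda>\<omega>. \<omega> (v, k))) {a}"
    by (simp add: pmf.rep_eq)
  also have "\<dots> = measure (FM d q p) ((\<lambda>\<omega>. \<omega> (v, k)) -` {a} \<inter> space (FM d q p))"
    using measurable_FM_action[OF assms, of k q p]
    by (intro measure_distr) (auto cong: measurable_cong_sets)
  also have "(\<lambda>\<omega>. \<omega> (v, k)) -` {a} \<inter> space (FM d q p) = {\<omega> \<in> space (FM d q p). \<omega> (v, k) = a}"
    by auto
  finally show ?thesis by simp
qed

lemma AE_FM_action:
  assumes "pmf (action_pmf d q p) a = 0"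
  shows "AE \<omega> in FM d q p. \<forall>v\<in>tree d. \<forall>k. \<omega> (v, k) \<noteq> a"
proof -
  interpret prob_space "FM d q p" by (rule prob_space_FM)
  have "AE \<omega> in FM d q p. \<omega> (v, k) \<noteq> a" if v: "v \<in> tree d" for v k
  proof -
    have "{\<omega> \<in> space (FM d q p). \<omega> (v, k) = a} \<in> events"
      using measurable_sets[OF measurable_FM_action[OF v, of k], of "{a}" q p]
      by (simp add: vimage_def Int_def conj_commute)
    thus ?thesis
      using prob_FM_action[OF v, of q p k a] assms
      by (subst AE_iff_measurable[OF _ refl]) (auto simp: emeasure_eq_measure)
  qed
  thus ?thesis by (simp only: AE_all_countable AE_ball_countable[OF countableI_type]) blast
qed

lemma pmf_action:
  assumes "0 \<le> q" "q \<le> 1" "0 \<le> p" "p \<le> 1" "d > 0"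
  shows "pmf (action_pmf d q p) Up = q * p"
    and "pmf (action_pmf d q p) (Down i) = (if i < d then q * (1 - p) / real d else 0)"
proof -
  have [simp]: "pmf (map_pmf Down X) (Down i) = pmf X i" for X i
    by (rule pmf_map_inj') (simp add: inj_def)
  have [simp]: "pmf (map_pmf Down X) Up = 0" for X
    by (auto simp: pmf_eq_0_set_pmf)
  have [simp]: "{..<d} \<noteq> {}" using assms by auto
  show "pmf (action_pmf d q p) Up = q * p"
    using assms by (simp add: action_pmf_def pmf_bind pmf_return)
  show "pmf (action_pmf d q p) (Down i) = (if i < d then q * (1 - p) / real d else 0)"
    using assms by (simp add: action_pmf_def pmf_bind pmf_return pmf_of_set indicator_def)
qed

text \<open>Because actions before index \<open>k\<close> are never consulted, the next action and
  the rest of the path are independent in first-step analysis.\<close>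

lemma hits_within_cong:
  "(\<And>j. k \<le> j \<Longrightarrow> A j = B j) \<Longrightarrow> hits_within T A k u x = hits_within T B k u x"
proof (induction T arbitrary: k u)
  case (Suc T)
  have "hits_within T A (Suc k) u' x = hits_within T B (Suc k) u' x" for u'
    by (rule Suc.IH) (use Suc.prems in auto)
  moreover have "A k = B k" by (rule Suc.prems) simp
  ultimately show ?case by (simp split: action.split)
qed simp

lemma measurable_hits_within:
  assumes "v \<in> tree d"
  shows "Measurable.pred (FM d q p) (\<lambda>\<omega>. hits_within T (\<lambda>j. \<omega> (v, j)) k u x)"
proof (induction T arbitrary: k u)
  case (Suc T)
  define H where "H a \<omega> \<longleftrightarrow> u = x \<or>
     (case a of
        Die \<Rightarrow> False
      | Up \<Rightarrow> hits_within T (\<lambda>j. \<omega> (v, j)) (Suc k) (tl u) x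
      | Down i \<Rightarrow> hits_within T (\<lambda>j. \<omega> (v, j)) (Suc k) (i # u) x)" for a \<omega>
  have "Measurable.pred (FM d q p) (H a)" for a
    unfolding H_def using Suc.IH by (cases a) auto
  from measurable_compose_countable[OF this measurable_FM_action[OF assms, of k]]
  show ?case by (simp add: H_def)
qed simp

lemma measurable_frog_hits:
  "v \<in> tree d \<Longrightarrow> Measurable.pred (FM d q p) (\<lambda>\<omega>. frog_hits \<omega> v x)"
  unfolding frog_hits_def by (intro pred_intros_countable measurable_hits_within)

lemma frog_hits_cong:
  "(\<And>j. \<omega> (v, j) = \<omega>' (v, j)) \<Longrightarrow> frog_hits \<omega> v x = frog_hits \<omega>' v x"
  by (simp add: frog_hits_def)

lemma prob_FM_disjoint:
  assumes "finite K" "disjoint_family_on J K" "\<And>k. k \<in> K \<Longrightarrow> J k \<subseteq> tree d \<times> UNIV"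
    and "\<And>k. k \<in> K \<Longrightarrow> Measurable.pred (FM d q p) (P k)"
    and "\<And>k \<omega> \<omega>'. k \<in> K \<Longrightarrow> (\<And>i. i \<in> J k \<Longrightarrow> \<omega> i = \<omega>' i) \<Longrightarrow> P k \<omega> = P k \<omega>'"
  shows "\<P>(\<omega> in FM d q p. \<forall>k\<in>K. P k \<omega>) = (\<Prod>k\<in>K. \<P>(\<omega> in FM d q p. P k \<omega>))"
proof -
  have "tree d \<noteq> {}" by (auto simp: tree_def)
  hence "tree d \<times> (UNIV :: nat set) \<noteq> {}" by simp
  from prob_PiM_disjoint[OF prob_space_measure_pmf this assms(1-3) assms(4)[unfolded FM_def] assms(5)]
  show ?thesis unfolding FM_def .
qed

lemma prob_FM_disjoint2:
  assumes "J1 \<inter> J2 = {}" "J1 \<subseteq> tree d \<times> UNIV" "J2 \<subseteq> tree d \<times> UNIV"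
    and "Measurable.pred (FM d q p) P1" "Measurable.pred (FM d q p) P2"
    and "\<And>\<omega> \<omega>'. (\<And>i. i \<in> J1 \<Longrightarrow> \<omega> i = \<omega>' i) \<Longrightarrow> P1 \<omega> = P1 \<omega>'"
    and "\<And>\<omega> \<omega>'. (\<And>i. i \<in> J2 \<Longrightarrow> \<omega> i = \<omega>' i) \<Longrightarrow> P2 \<omega> = P2 \<omega>'"
  shows "\<P>(\<omega> in FM d q p. P1 \<omega> \<and> P2 \<omega>) = \<P>(\<omega> in FM d q p. P1 \<omega>) * \<P>(\<omega> in FM d q p. P2 \<omega>)"
proof -
  have eq: "\<P>(\<omega> in FM d q p. \<forall>k\<in>{True, False}. (if k then P1 else P2) \<omega>) =
      (\<Prod>k\<in>{True, False}. \<P>(\<omega> in FM d q p. (if k then P1 else P2) \<omega>))"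
  proof (rule prob_FM_disjoint[where J = "\<lambda>k. if k then J1 else J2"])
    fix k :: bool and \<omega> \<omega>' :: "vertex \<times> nat \<Rightarrow> action"
    assume "\<And>i. i \<in> (if k then J1 else J2) \<Longrightarrow> \<omega> i = \<omega>' i"
    thus "(if k then P1 else P2) \<omega> = (if k then P1 else P2) \<omega>'"
      using assms(6,7)[of \<omega> \<omega>'] by (cases k) auto
  qed (use assms in \<open>auto simp: disjoint_family_on_def\<close>)
  have ball: "(\<forall>k\<in>{True, False}. R k) \<longleftrightarrow> R True \<and> R False" for R by auto
  from eq[unfolded ball] show ?thesis by simp
qed

subsection \<open>Relays over two generations\<close>

definition grandchildren :: "nat \<Rightarrow> vertex \<Rightarrow> vertex set" where
  "grandchildren d v = (\<lambda>(i, j). j # i # v) ` ({..<d} \<times> {..<d})"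

lemma finite_grandchildren: "finite (grandchildren d v)"
  by (simp add: grandchildren_def)

lemma card_grandchildren: "card (grandchildren d v) = d\<^sup>2"
  unfolding grandchildren_def
  by (subst card_image) (auto simp: inj_on_def power2_eq_square)

lemma grandchildrenE:
  assumes "w \<in> grandchildren d v"
  obtains i j where "i < d" "j < d" "w = j # i # v"
  using assms by (auto simp: grandchildren_def)

lemma length_grandchildren: "w \<in> grandchildren d v \<Longrightarrow> length w = length v + 2"
  by (auto simp: grandchildren_def)

lemma grandchildren_tree: "v \<in> tree d \<Longrightarrow> w \<in> grandchildren d v \<Longrightarrow> w \<in> tree d \<and> tl w \<in> tree d"
  by (auto simp: grandchildren_def tree_def)

text \<open>
  Whether \<open>v\<close> relays to \<open>w\<close> is decided by the frogs of \<open>v\<close> and its children alone, so it is independent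
  of everything that happens in the subtrees of the grandchildren.
\<close>

definition relay :: "(vertex \<times> nat \<Rightarrow> action) \<Rightarrow> vertex \<Rightarrow> vertex \<Rightarrow> bool" where
  "relay \<omega> v w \<longleftrightarrow> frog_hits \<omega> v w \<or> frog_hits \<omega> v (tl w) \<and> frog_hits \<omega> (tl w) w"

text \<open>The hit of the root sits in the base case, so that survival of the branching process and
  the return to the root are estimated by one recursion.\<close>

fun relays_return :: "nat \<Rightarrow> nat \<Rightarrow> (vertex \<times> nat \<Rightarrow> action) \<Rightarrow> vertex \<Rightarrow> bool" where
  "relays_return d 0 \<omega> v \<longleftrightarrow> frog_hits \<omega> v []"
| "relays_return d (Suc n) \<omega> v \<longleftrightarrow> (\<exists>w\<in>grandchildren d v. relay \<omega> v w \<and> relays_return d n \<omega> w)"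

lemma relays_return_activated:
  assumes "activated d \<omega> v" "v \<in> tree d" "relays_return d n \<omega> v"
  shows "\<exists>u\<in>tree d. length u = length v + 2 * n \<and> activated d \<omega> u \<and> frog_hits \<omega> u []"
  using assms
proof (induction n arbitrary: v)
  case (Suc n)
  from Suc.prems(3) obtain w where w: "w \<in> grandchildren d v" "relay \<omega> v w" "relays_return d n \<omega> w"
    by auto
  note wt = grandchildren_tree[OF Suc.prems(2) w(1)]
  have "activated d \<omega> w"
    using w(2) activated_frog_hits[OF Suc.prems(1,2)] activated_frog_hits[of d \<omega> "tl w" w] wt
    by (auto simp: relay_def)
  from Suc.IH[OF this _ w(3)] wt length_grandchildren[OF w(1)] show ?case by simp
qed auto

lemma measurable_relay:
  "v \<in> tree d \<Longrightarrow> w \<in> grandchildren d v \<Longrightarrow> Measurable.pred (FM d q p) (\<lambda>\<omega>. relay \<omega> v w)"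
  unfolding relay_def using grandchildren_tree[of v d w]
  by (intro pred_intros_logic measurable_frog_hits) auto

lemma measurable_relays_return:
  "v \<in> tree d \<Longrightarrow> Measurable.pred (FM d q p) (\<lambda>\<omega>. relays_return d n \<omega> v)"
proof (induction n arbitrary: v)
  case (Suc n)
  have "countable (grandchildren d v)" by (rule countable_finite[OF finite_grandchildren])
  thus ?case
    unfolding relays_return.simps using Suc grandchildren_tree[OF Suc.prems]
    by (intro pred_intros_countable_bounded pred_intros_logic measurable_relay) auto
qed (simp add: measurable_frog_hits)

section \<open>Locality of relays\<close>

definition subtree :: "nat \<Rightarrow> vertex \<Rightarrow> vertex set" where
  "subtree d v = (\<lambda>xs. xs @ v) ` tree d"

lemma subtree_subset_tree: "v \<in> tree d \<Longrightarrow> subtree d v \<subseteq> tree d"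
  by (auto simp: subtree_def tree_def)

lemma subtree_self: "v \<in> subtree d v"
  by (auto simp: subtree_def tree_def)

lemma subtree_Cons: "i < d \<Longrightarrow> subtree d (i # v) \<subseteq> subtree d v"
proof
  fix u assume "i < d" "u \<in> subtree d (i # v)"
  then obtain xs where "u = (xs @ [i]) @ v" "xs @ [i] \<in> tree d" by (auto simp: subtree_def tree_def)
  thus "u \<in> subtree d v" unfolding subtree_def by blast
qed

lemma subtree_grandchildren: "w \<in> grandchildren d v \<Longrightarrow> subtree d w \<subseteq> subtree d v"
  by (erule grandchildrenE) (use subtree_Cons in blast)

lemma length_subtree: "u \<in> subtree d v \<Longrightarrow> length v \<le> length u"
  by (auto simp: subtree_def)

lemma disjoint_subtrees:
  assumes "length v = length w" "v \<noteq> w"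
  shows "subtree d v \<inter> subtree d w = {}"
  using assms by (auto simp: subtree_def)

lemma relay_cong:
  assumes "w \<in> grandchildren d v" "\<And>u j. u = v \<or> length u = Suc (length v) \<and> u \<in> subtree d v \<Longrightarrow> \<omega> (u, j) = \<omega>' (u, j)"
  shows "relay \<omega> v w = relay \<omega>' v w"
proof -
  from assms(1) have "length (tl w) = Suc (length v) \<and> tl w \<in> subtree d v"
    using subtree_Cons subtree_self by (elim grandchildrenE) fastforce
  hence "frog_hits \<omega> (tl w) x = frog_hits \<omega>' (tl w) x" for x
    by (intro frog_hits_cong assms(2)) auto
  moreover have "frog_hits \<omega> v x = frog_hits \<omega>' v x" for x
    by (intro frog_hits_cong assms(2)) auto
  ultimately show ?thesis by (simp add: relay_def)
qed

text \<open>The recursion consults only frogs that start in the subtree of \<open>v\<close>, even if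
  they wander out of it. Hence the events of different grandchildren use disjoint sets of
  actions.\<close>

lemma relays_return_cong:
  "(\<And>u j. u \<in> subtree d v \<Longrightarrow> \<omega> (u, j) = \<omega>' (u, j)) \<Longrightarrow>
    relays_return d n \<omega> v = relays_return d n \<omega>' v"
proof (induction n arbitrary: v)
  case 0
  thus ?case using subtree_self by (auto intro!: frog_hits_cong)
next
  case (Suc n)
  have "relay \<omega> v w = relay \<omega>' v w" if "w \<in> grandchildren d v" for w
    by (rule relay_cong[OF that]) (use Suc.prems subtree_self in auto)
  moreover have "relays_return d n \<omega> w = relays_return d n \<omega>' w" if "w \<in> grandchildren d v" for w
    by (rule Suc.IH) (use Suc.prems subtree_grandchildren[OF that] in auto)
  ultimately show ?case by auto
qed

text \<open>A second-order bound, by induction with nonnegative terms discarded. It turns the chance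
  \<open>(1 - x) ^ k\<close> that \<open>k\<close> marked vertices all fail into a linear gain and a
  quadratic loss in \<open>x\<close>.\<close>

lemma power_one_minus_le:
  fixes x :: real
  assumes "0 \<le> x" "x \<le> 1"
  shows "(1 - x) ^ k \<le> 1 - real k * x + (real k)\<^sup>2 * x\<^sup>2"
proof (induction k)
  case (Suc k)
  have "(1 - x) ^ Suc k \<le> (1 - x) * (1 - real k * x + (real k)\<^sup>2 * x\<^sup>2)"
    unfolding power_Suc by (rule mult_left_mono[OF Suc.IH]) (use assms in simp)
  also have "\<dots> = 1 - real (Suc k) * x + (real (Suc k))\<^sup>2 * x\<^sup>2 -
      ((real k + 1) * x\<^sup>2 + (real k)\<^sup>2 * (x * x\<^sup>2))"
    by (simp add: power2_eq_square algebra_simps)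
  also have "\<dots> \<le> 1 - real (Suc k) * x + (real (Suc k))\<^sup>2 * x\<^sup>2"
  proof -
    have "0 \<le> (real k + 1) * x\<^sup>2 + (real k)\<^sup>2 * (x * x\<^sup>2)"
      using assms by (intro add_nonneg_nonneg mult_nonneg_nonneg) auto
    thus ?thesis by linarith
  qed
  finally show ?case .
qed simp

text \<open>
  The hypothesis \<open>ind\<close> holds if, conditionally on the set of marked \<open>w\<close>, the events \<open>Y w\<close> are
  independent with probability at least \<open>x\<close>.
\<close>

lemma (in prob_space) prob_marked_ge:
  fixes X Y :: "'w \<Rightarrow> 'a \<Rightarrow> bool"
  assumes W: "finite W" and x: "0 \<le> x" "x \<le> 1"
    and X: "\<And>w. w \<in> W \<Longrightarrow> Measurable.pred M (X w)"
    and Y: "\<And>w. w \<in> W \<Longrightarrow> Measurable.pred M (Y w)"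
    and ind: "\<And>S. S \<subseteq> W \<Longrightarrow>
      \<P>(\<omega> in M. (\<forall>w\<in>W. X w \<omega> \<longleftrightarrow> w \<in> S) \<and> (\<forall>w\<in>S. \<not> Y w \<omega>))
      \<le> \<P>(\<omega> in M. \<forall>w\<in>W. X w \<omega> \<longleftrightarrow> w \<in> S) * (1 - x) ^ card S"
  shows "x * (\<Sum>w\<in>W. \<P>(\<omega> in M. X w \<omega>)) - x\<^sup>2 * (real (card W))\<^sup>2
    \<le> \<P>(\<omega> in M. \<exists>w\<in>W. X w \<omega> \<and> Y w \<omega>)"
proof -
  \<comment> \<open>The events \<open>Z S\<close>, with \<open>S\<close> a subset of
    \<open>W\<close>, fix the exact set of marked elements and partition the space, so every
    probability can be summed over \<open>S\<close>.\<close>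
  define Z where "Z S = {\<omega> \<in> space M. \<forall>w\<in>W. X w \<omega> \<longleftrightarrow> w \<in> S}" for S
  have Xs: "{\<omega> \<in> space M. X w \<omega>} \<in> events" and Ys: "{\<omega> \<in> space M. Y w \<omega>} \<in> events"
    if "w \<in> W" for w using X Y that by (auto simp: pred_def)
  have Z: "Z S \<in> events" for S
  proof -
    have "Measurable.pred M (\<lambda>\<omega>. \<forall>w\<in>W. X w \<omega> \<longleftrightarrow> w \<in> S)"
      by (intro pred_intros_finite W pred_intros_logic X) auto
    thus ?thesis by (simp add: Z_def pred_def)
  qed
  have split: "prob E = (\<Sum>S\<in>Pow W. prob (E \<inter> Z S))" if E: "E \<in> events" for E
  proof -
    have "E = (\<Union>S\<in>Pow W. E \<inter> Z S)"
    proof (intro equalityI subsetI)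
      fix \<omega> assume "\<omega> \<in> E"
      moreover have "\<omega> \<in> Z {w \<in> W. X w \<omega>}"
        using \<open>\<omega> \<in> E\<close> sets.sets_into_space[OF E] by (auto simp: Z_def)
      ultimately show "\<omega> \<in> (\<Union>S\<in>Pow W. E \<inter> Z S)"
        by (intro UN_I[of "{w \<in> W. X w \<omega>}"]) auto
    qed auto
    hence "prob E = prob (\<Union>S\<in>Pow W. E \<inter> Z S)" by (rule arg_cong)
    also have "\<dots> = (\<Sum>S\<in>Pow W. prob (E \<inter> Z S))"
    proof (rule finite_measure_finite_Union)
      have "S = T" if "S \<subseteq> W" "T \<subseteq> W" "\<omega> \<in> Z S" "\<omega> \<in> Z T" for S T \<omega>
      proof -
        from that(3,4) have "\<forall>w\<in>W. w \<in> S \<longleftrightarrow> w \<in> T" unfolding Z_def by blast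
        with that(1,2) show ?thesis by blast
      qed
      thus "disjoint_family_on (\<lambda>S. E \<inter> Z S) (Pow W)"
        unfolding disjoint_family_on_def by blast
    qed (use W E Z in auto)
    finally show ?thesis .
  qed
  define G where "G = {\<omega> \<in> space M. \<exists>w\<in>W. X w \<omega> \<and> Y w \<omega>}"
  have "{\<omega> \<in> space M. X w \<omega> \<and> Y w \<omega>} \<in> events" if "w \<in> W" for w
    using sets.Int[OF Xs Ys, OF that that] by (simp add: Int_def conj_ac)
  moreover have "G = (\<Union>w\<in>W. {\<omega> \<in> space M. X w \<omega> \<and> Y w \<omega>})" by (auto simp: G_def)
  ultimately have G: "G \<in> events" using W by auto
  have marks: "(\<Sum>w\<in>W. \<P>(\<omega> in M. X w \<omega>)) = (\<Sum>S\<in>Pow W. prob (Z S) * real (card S))"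
  proof -
    have "\<P>(\<omega> in M. X w \<omega>) = (\<Sum>S\<in>Pow W. if w \<in> S then prob (Z S) else 0)" if "w \<in> W" for w
    proof -
      have "{\<omega> \<in> space M. X w \<omega>} \<inter> Z S = (if w \<in> S then Z S else {})" for S
        using that by (auto simp: Z_def)
      thus ?thesis unfolding split[OF Xs[OF that]] by (intro sum.cong) auto
    qed
    hence "(\<Sum>w\<in>W. \<P>(\<omega> in M. X w \<omega>)) =
        (\<Sum>w\<in>W. \<Sum>S\<in>Pow W. if w \<in> S then prob (Z S) else 0)" by simp
    also have "\<dots> = (\<Sum>S\<in>Pow W. \<Sum>w\<in>W. if w \<in> S then prob (Z S) else 0)" by (rule sum.swap)
    also have "\<dots> = (\<Sum>S\<in>Pow W. prob (Z S) * real (card S))"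
    proof (rule sum.cong)
      fix S assume "S \<in> Pow W"
      hence "W \<inter> {w. w \<in> S} = S" by auto
      thus "(\<Sum>w\<in>W. if w \<in> S then prob (Z S) else 0) = prob (Z S) * real (card S)"
        using W by (subst sum.If_cases) auto
    qed simp
    finally show ?thesis .
  qed
  have total: "(\<Sum>S\<in>Pow W. prob (Z S)) = 1"
    using split[OF sets.top] by (simp add: prob_space Z_def Int_def)
  \<comment> \<open>Outside \<open>G\<close>, on \<open>Z S\<close>, the event \<open>Y\<close>
    fails throughout \<open>S\<close>; this is what \<open>ind\<close> bounds.\<close>
  have "1 - prob G = prob (space M - G)" by (rule prob_compl[OF G, symmetric])
  also have "\<dots> = (\<Sum>S\<in>Pow W. prob ((space M - G) \<inter> Z S))"
    by (rule split) (use G in auto)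
  also have "\<dots> \<le> (\<Sum>S\<in>Pow W. prob (Z S) * (1 - x) ^ card S)"
  proof (rule sum_mono)
    fix S assume S: "S \<in> Pow W"
    have "(space M - G) \<inter> Z S =
        {\<omega> \<in> space M. (\<forall>w\<in>W. X w \<omega> \<longleftrightarrow> w \<in> S) \<and> (\<forall>w\<in>S. \<not> Y w \<omega>)}"
      using S by (auto simp: G_def Z_def)
    thus "prob ((space M - G) \<inter> Z S) \<le> prob (Z S) * (1 - x) ^ card S"
      using ind[of S] S by (simp add: Z_def)
  qed
  also have "\<dots> \<le> (\<Sum>S\<in>Pow W. prob (Z S) * (1 - real (card S) * x + (real (card W))\<^sup>2 * x\<^sup>2))"
  proof (intro sum_mono mult_left_mono)
    fix S assume "S \<in> Pow W"
    hence "card S \<le> card W" using W by (auto intro: card_mono)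
    hence "(real (card S))\<^sup>2 * x\<^sup>2 \<le> (real (card W))\<^sup>2 * x\<^sup>2"
      by (intro mult_right_mono power_mono) auto
    with power_one_minus_le[OF x, of "card S"]
    show "(1 - x) ^ card S \<le> 1 - real (card S) * x + (real (card W))\<^sup>2 * x\<^sup>2" by linarith
  qed simp
  also have "\<dots> = (\<Sum>S\<in>Pow W. prob (Z S)) - x * (\<Sum>S\<in>Pow W. prob (Z S) * real (card S)) +
      (real (card W))\<^sup>2 * x\<^sup>2 * (\<Sum>S\<in>Pow W. prob (Z S))"
    by (simp add: algebra_simps sum.distrib sum_subtractf sum_distrib_left)
  finally show ?thesis unfolding marks total by (simp add: G_def mult.commute)
qed

subsection \<open>Hitting probabilities\<close>

text \<open>The one-step equations serve as the definition, so the analytic estimates stay free of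
  measure theory. Neither the name of the frog nor its count of used actions occurs, since all
  actions have the same law.\<close>

fun hit_prob :: "nat \<Rightarrow> real \<Rightarrow> real \<Rightarrow> nat \<Rightarrow> vertex \<Rightarrow> vertex \<Rightarrow> real" where
  "hit_prob d q p 0 u x = (if u = x then 1 else 0)"
| "hit_prob d q p (Suc T) u x = (if u = x then 1 else
     q * p * hit_prob d q p T (tl u) x + q * (1 - p) / real d * (\<Sum>i<d. hit_prob d q p T (i # u) x))"

text \<open>First-step analysis: action \<open>k\<close> and the later actions are disjoint sets of
  coordinates, so the probability of each branch factors. The induction runs over all offsets
  \<open>k\<close>.\<close>

lemma hit_prob_le:
  assumes "0 \<le> q" "q \<le> 1" "0 \<le> p" "p \<le> 1" "d > 0" and v: "v \<in> tree d"
  shows "hit_prob d q p T u x \<le> \<P>(\<omega> in FM d q p. hits_within T (\<lambda>j. \<omega> (v, j)) k u x)"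
proof -
  interpret prob_space "FM d q p" by (rule prob_space_FM)
  show ?thesis
  proof (induction T arbitrary: k u)
    case 0
    show ?case by (simp add: prob_space)
  next
    case (Suc T)
    show ?case
    proof (cases "u = x")
      case False
      define N where "N a = (case a of Down i \<Rightarrow> i # u | _ \<Rightarrow> tl u)" for a
      define E where "E a = {\<omega> \<in> space (FM d q p).
        \<omega> (v, k) = a \<and> hits_within T (\<lambda>j. \<omega> (v, j)) (Suc k) (N a) x}" for a
      \<comment> \<open>The actions that can still lead to a hit: \<open>Die\<close> ends the path,
        and \<open>Down i\<close> with \<open>i\<close> at least \<open>d\<close> has mass
        0.\<close>
      define As where "As = insert Up (Down ` {..<d})"
      have fin: "finite As" by (simp add: As_def)
      have act: "Measurable.pred (FM d q p) (\<lambda>\<omega>. \<omega> (v, k) = a)" for a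
        by (rule measurable_compose[OF measurable_FM_action[OF v]]) simp
      have E: "E a \<in> events" for a
        using pred_intros_logic(3)[OF act measurable_hits_within[OF v]]
        by (simp add: E_def pred_def)
      have pE: "prob (E a) \<ge> pmf (action_pmf d q p) a * hit_prob d q p T (N a) x" for a
      proof -
        have "prob (E a) = \<P>(\<omega> in FM d q p. \<omega> (v, k) = a) *
            \<P>(\<omega> in FM d q p. hits_within T (\<lambda>j. \<omega> (v, j)) (Suc k) (N a) x)"
          unfolding E_def
          by (rule prob_FM_disjoint2[where ?J1.0 = "{(v, k)}" and ?J2.0 = "{v} \<times> {Suc k..}"])
            (use v in \<open>auto intro!: act measurable_hits_within hits_within_cong\<close>)
        also have "\<dots> \<ge> pmf (action_pmf d q p) a * hit_prob d q p T (N a) x"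
          unfolding prob_FM_action[OF v] by (intro mult_left_mono Suc.IH) simp
        finally show ?thesis .
      qed
      have "hit_prob d q p (Suc T) u x =
          (\<Sum>a\<in>As. pmf (action_pmf d q p) a * hit_prob d q p T (N a) x)"
        using False assms unfolding As_def
        by (subst sum.insert) (auto simp: pmf_action N_def sum.reindex inj_on_def sum_distrib_left)
      also have "\<dots> \<le> (\<Sum>a\<in>As. prob (E a))" by (intro sum_mono pE)
      also have "\<dots> = prob (\<Union>a\<in>As. E a)"
        by (rule finite_measure_finite_Union[symmetric])
          (use fin E in \<open>auto simp: disjoint_family_on_def E_def\<close>)
      also have "\<dots> \<le> \<P>(\<omega> in FM d q p. hits_within (Suc T) (\<lambda>j. \<omega> (v, j)) k u x)"
      proof (rule finite_measure_mono)
        show "(\<Union>a\<in>As. E a) \<subseteq> {\<omega> \<in> space (FM d q p). hits_within (Suc T) (\<lambda>j. \<omega> (v, j)) k u x}"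
          by (auto simp: E_def As_def N_def)
        show "{\<omega> \<in> space (FM d q p). hits_within (Suc T) (\<lambda>j. \<omega> (v, j)) k u x} \<in> events"
          using measurable_hits_within[OF v] by (simp only: pred_def)
      qed
      finally show ?thesis .
    qed (simp add: prob_space)
  qed
qed

section \<open>Hitting probabilities without a time limit\<close>

definition reach_prob :: "nat \<Rightarrow> real \<Rightarrow> real \<Rightarrow> vertex \<Rightarrow> vertex \<Rightarrow> real" where
  "reach_prob d q p u x = (SUP T. hit_prob d q p T u x)"

context
  fixes d :: nat and q p :: real
  assumes d: "d > 0" and q: "0 \<le> q" "q \<le> 1" and p: "0 \<le> p" "p \<le> 1"
begin

lemma hit_prob_bounds: "0 \<le> hit_prob d q p T u x \<and> hit_prob d q p T u x \<le> 1"
proof (induction T arbitrary: u)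
  case (Suc T)
  let ?S = "\<Sum>i<d. hit_prob d q p T (i # u) x"
  have "?S \<le> (\<Sum>i<d. 1)" by (intro sum_mono) (use Suc.IH in auto)
  hence "q * p * hit_prob d q p T (tl u) x + q * (1 - p) / real d * ?S
      \<le> q * p * 1 + q * (1 - p) / real d * real d"
    by (intro add_mono mult_left_mono) (use Suc.IH q p in auto)
  also have "\<dots> = q" using d by (simp add: field_simps)
  finally have "q * p * hit_prob d q p T (tl u) x + q * (1 - p) / real d * ?S \<le> 1"
    using q by simp
  moreover have "0 \<le> ?S" by (intro sum_nonneg) (use Suc.IH in auto)
  hence "0 \<le> q * p * hit_prob d q p T (tl u) x + q * (1 - p) / real d * ?S"
    using Suc.IH q p by (intro add_nonneg_nonneg mult_nonneg_nonneg) auto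
  ultimately show ?case by simp
qed simp

lemma hit_prob_mono_Suc: "hit_prob d q p T u x \<le> hit_prob d q p (Suc T) u x"
proof (induction T arbitrary: u)
  case 0
  show ?case using hit_prob_bounds[of "Suc 0" u x] by auto
next
  case (Suc T)
  have "q * p * hit_prob d q p T (tl u) x + q * (1 - p) / real d * (\<Sum>i<d. hit_prob d q p T (i # u) x)
      \<le> q * p * hit_prob d q p (Suc T) (tl u) x +
         q * (1 - p) / real d * (\<Sum>i<d. hit_prob d q p (Suc T) (i # u) x)"
    by (intro add_mono mult_left_mono sum_mono Suc.IH) (use q p in auto)
  thus ?case by (subst (1 2) hit_prob.simps) simp
qed

lemma incseq_hit_prob: "incseq (\<lambda>T. hit_prob d q p T u x)"
  by (rule incseq_SucI) (rule hit_prob_mono_Suc)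

text \<open>A form of the strong Markov property: reaching \<open>w\<close> and then
  \<open>x\<close> is one way to reach \<open>x\<close>. Unfolding the recursion for
  \<open>S\<close> multiplies every branch by the same factor; the case \<open>u = x\<close> is
  separate because the recursion stops there.\<close>

lemma hit_prob_mult: "hit_prob d q p S u w * hit_prob d q p T w x \<le> hit_prob d q p (S + T) u x"
proof (induction S arbitrary: u)
  case 0
  show ?case using hit_prob_bounds[of T u x] by auto
next
  case (Suc S)
  show ?case
  proof (cases "u = w \<or> u = x")
    case True
    thus ?thesis
    proof
      assume "u = w"
      thus ?thesis using incseqD[OF incseq_hit_prob, of T "Suc S + T" u x] by simp
    next
      assume "u = x"
      thus ?thesis using hit_prob_bounds[of "Suc S" u w] hit_prob_bounds[of T w x]
        by (simp add: mult_le_one del: hit_prob.simps(2)) (simp add: mult_le_one)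
    qed
  next
    case False
    let ?h = "hit_prob d q p"
    have "?h (Suc S) u w * ?h T w x =
        q * p * (?h S (tl u) w * ?h T w x) + q * (1 - p) / real d * (\<Sum>i<d. ?h S (i # u) w * ?h T w x)"
      using False by (simp add: distrib_right sum_distrib_right[symmetric])
    also have "\<dots> \<le> q * p * ?h (S + T) (tl u) x + q * (1 - p) / real d * (\<Sum>i<d. ?h (S + T) (i # u) x)"
      by (intro add_mono mult_left_mono sum_mono Suc.IH) (use q p in auto)
    also have "\<dots> = ?h (Suc S + T) u x" using False by simp
    finally show ?thesis .
  qed
qed

lemma bdd_above_hit_prob: "bdd_above (range (\<lambda>T. hit_prob d q p T u x))"
  by (rule bdd_aboveI2[where M = 1]) (use hit_prob_bounds in blast)

lemma hit_prob_tendsto: "(\<lambda>T. hit_prob d q p T u x) \<longlonglongrightarrow> reach_prob d q p u x"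
  unfolding reach_prob_def by (rule LIMSEQ_incseq_SUP[OF bdd_above_hit_prob incseq_hit_prob])

lemma hit_prob_le_reach_prob: "hit_prob d q p T u x \<le> reach_prob d q p u x"
  unfolding reach_prob_def by (rule cSUP_upper[OF _ bdd_above_hit_prob]) simp

lemma reach_prob_nonneg: "0 \<le> reach_prob d q p u x"
  using hit_prob_bounds[of 0 u x] hit_prob_le_reach_prob[of 0 u x] by linarith

lemma reach_prob_le_1: "reach_prob d q p u x \<le> 1"
  by (rule LIMSEQ_le_const2[OF hit_prob_tendsto]) (use hit_prob_bounds in blast)

lemma reach_prob_self: "reach_prob d q p u u = 1"
  using hit_prob_le_reach_prob[of 0 u u] reach_prob_le_1[of u u] by simp

lemma reach_prob_step:
  assumes "u \<noteq> x"
  shows "reach_prob d q p u x = q * p * reach_prob d q p (tl u) x +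
    q * (1 - p) / real d * (\<Sum>i<d. reach_prob d q p (i # u) x)"
proof (rule LIMSEQ_unique)
  show "(\<lambda>T. hit_prob d q p (Suc T) u x) \<longlonglongrightarrow> reach_prob d q p u x"
    by (rule LIMSEQ_Suc[OF hit_prob_tendsto])
  show "(\<lambda>T. hit_prob d q p (Suc T) u x) \<longlonglongrightarrow> q * p * reach_prob d q p (tl u) x +
      q * (1 - p) / real d * (\<Sum>i<d. reach_prob d q p (i # u) x)"
    using assms by (simp, intro tendsto_intros hit_prob_tendsto) (use d in auto)
qed

lemma reach_prob_mult: "reach_prob d q p u w * reach_prob d q p w x \<le> reach_prob d q p u x"
  by (rule LIMSEQ_le_const2[OF tendsto_mult[OF hit_prob_tendsto hit_prob_tendsto]])
    (use order_trans[OF hit_prob_mult hit_prob_le_reach_prob] in blast)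

lemma reach_prob_le_prob_frog_hits:
  assumes v: "v \<in> tree d"
  shows "reach_prob d q p v x \<le> \<P>(\<omega> in FM d q p. frog_hits \<omega> v x)"
proof (rule LIMSEQ_le_const2[OF hit_prob_tendsto], intro exI allI impI)
  fix T
  interpret prob_space "FM d q p" by (rule prob_space_FM)
  have "hit_prob d q p T v x \<le> \<P>(\<omega> in FM d q p. hits_within T (\<lambda>j. \<omega> (v, j)) 0 v x)"
    by (rule hit_prob_le) (use q p d v in auto)
  also have "\<dots> \<le> \<P>(\<omega> in FM d q p. frog_hits \<omega> v x)"
    by (rule finite_measure_mono)
      (use measurable_frog_hits[OF v] in \<open>auto simp: frog_hits_def pred_def\<close>)
  finally show "hit_prob d q p T v x \<le> \<P>(\<omega> in FM d q p. frog_hits \<omega> v x)" .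
qed

text \<open>An infimum over vertices takes the place of a symmetry argument. It may range over lists
  outside the tree, since the labels of ancestors do not influence the moves.\<close>

definition up_prob :: real where
  "up_prob = (INF u\<in>{u. u \<noteq> []}. reach_prob d q p u (tl u))"

text \<open>Restricted to the tree, since a child with index at least \<open>d\<close> is never
  entered. The infimum absorbs the dependence on the level caused by the root, where an upward move
  stays in place.\<close>

definition down_prob :: real where
  "down_prob = (INF (u, i)\<in>tree d \<times> {..<d}. reach_prob d q p u (i # u))"

lemma up_prob_le: "up_prob \<le> reach_prob d q p (i # u) u"
proof -
  have "bdd_below ((\<lambda>u. reach_prob d q p u (tl u)) ` {u. u \<noteq> []})"
    by (rule bdd_belowI2[where m = 0]) (rule reach_prob_nonneg)
  from cINF_lower[OF this, of "i # u"] show ?thesis by (simp add: up_prob_def)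
qed

lemma down_prob_le:
  assumes "u \<in> tree d" "i < d"
  shows "down_prob \<le> reach_prob d q p u (i # u)"
proof -
  have "bdd_below ((\<lambda>(u, i). reach_prob d q p u (i # u)) ` (tree d \<times> {..<d}))"
    by (rule bdd_belowI2[where m = 0]) (auto simp: reach_prob_nonneg)
  from cINF_lower[OF this, of "(u, i)"] assms show ?thesis by (simp add: down_prob_def)
qed

lemma up_prob_nonneg: "0 \<le> up_prob"
  unfolding up_prob_def by (rule cINF_greatest) (auto simp: reach_prob_nonneg)

lemma down_prob_nonneg: "0 \<le> down_prob"
  unfolding down_prob_def
  by (rule cINF_greatest) (use d in \<open>auto simp: reach_prob_nonneg tree_def\<close>)

lemma up_prob_le_1: "up_prob \<le> 1"
  using up_prob_le[of undefined "[]"] reach_prob_le_1[of "[undefined]" "[]"] by linarith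

lemma down_prob_le_1: "down_prob \<le> 1"
  using down_prob_le[of "[]" 0] d reach_prob_le_1[of "[]" "[0]"] by (simp add: tree_def)

text \<open>First step from \<open>u\<close>: up reaches the parent at once; down leads to a child,
  from which two successive climbs reach it, each with probability at least
  \<open>up_prob\<close>.\<close>

lemma up_prob_ge: "q * p + q * (1 - p) * up_prob\<^sup>2 \<le> up_prob"
  unfolding up_prob_def[symmetric]
\<comment> \<open>Only the infimum on the right is unfolded. The bound is then shown for each
  \<open>u\<close>, with \<open>up_prob\<close> kept as a lower bound at the other vertices.\<close>
proof (subst (2) up_prob_def, rule cINF_greatest)
  fix u :: vertex assume "u \<in> {u. u \<noteq> []}"
  then obtain b u' where u: "u = b # u'" by (cases u) auto
  have two: "up_prob\<^sup>2 \<le> reach_prob d q p (i # u) u'" for i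
  proof -
    have "up_prob\<^sup>2 \<le> reach_prob d q p (i # u) u * reach_prob d q p u u'"
      unfolding power2_eq_square u by (intro mult_mono up_prob_le up_prob_nonneg reach_prob_nonneg)
    also have "\<dots> \<le> reach_prob d q p (i # u) u'" by (rule reach_prob_mult)
    finally show ?thesis .
  qed
  have "q * p + q * (1 - p) * up_prob\<^sup>2 =
      q * p * 1 + q * (1 - p) / real d * (\<Sum>i<d. up_prob\<^sup>2)"
    using d by simp
  also have "\<dots> \<le> q * p * reach_prob d q p u' u' +
      q * (1 - p) / real d * (\<Sum>i<d. reach_prob d q p (i # u) u')"
    by (intro add_mono mult_left_mono sum_mono two) (use q p in \<open>auto simp: reach_prob_self\<close>)
  also have "\<dots> = reach_prob d q p u u'"
    by (subst (3) reach_prob_step) (auto simp: u)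
  finally show "q * p + q * (1 - p) * up_prob\<^sup>2 \<le> reach_prob d q p u (tl u)" by (simp add: u)
qed auto

text \<open>First step from \<open>u\<close>: up requires two descents, the target child itself
  requires nothing more, and each of the \<open>d - 1\<close> siblings requires one climb and one
  descent.\<close>

lemma down_prob_ge:
  "q * p * down_prob\<^sup>2 + q * (1 - p) / real d * (1 + (real d - 1) * (up_prob * down_prob)) \<le> down_prob"
proof (subst (3) down_prob_def, rule cINF_greatest)
  fix ui assume "ui \<in> tree d \<times> {..<d}"
  then obtain u i where ui: "ui = (u, i)" "u \<in> tree d" "i < d" by auto
  \<comment> \<open>At the root \<open>tl u = u\<close>, so a single descent remains and the square
    is bounded by \<open>down_prob\<close>. Elsewhere the parent reaches the target through
    \<open>u\<close>.\<close>
  have up: "down_prob\<^sup>2 \<le> reach_prob d q p (tl u) (i # u)"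
  proof (cases u)
    case Nil
    have "down_prob\<^sup>2 \<le> down_prob"
      using down_prob_nonneg down_prob_le_1 by (simp add: power2_eq_square mult_left_le)
    also have "\<dots> \<le> reach_prob d q p (tl u) (i # u)"
      using down_prob_le[OF ui(2,3)] Nil by simp
    finally show ?thesis .
  next
    case (Cons b u')
    have "down_prob\<^sup>2 \<le> reach_prob d q p u' u * reach_prob d q p u (i # u)"
      unfolding power2_eq_square using ui Cons
      by (intro mult_mono down_prob_nonneg reach_prob_nonneg)
        (auto intro!: down_prob_le simp: tree_def)
    also have "\<dots> \<le> reach_prob d q p u' (i # u)" by (rule reach_prob_mult)
    finally show ?thesis by (simp add: Cons)
  qed
  have side: "up_prob * down_prob \<le> reach_prob d q p (k # u) (i # u)" for k
  proof -
    have "up_prob * down_prob \<le> reach_prob d q p (k # u) u * reach_prob d q p u (i # u)"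
      by (intro mult_mono up_prob_le down_prob_le ui reach_prob_nonneg down_prob_nonneg)
    also have "\<dots> \<le> reach_prob d q p (k # u) (i # u)" by (rule reach_prob_mult)
    finally show ?thesis .
  qed
  have "1 + (real d - 1) * (up_prob * down_prob) =
      reach_prob d q p (i # u) (i # u) + (\<Sum>k\<in>{..<d} - {i}. up_prob * down_prob)"
    using ui d by (simp add: reach_prob_self of_nat_diff)
  also have "\<dots> \<le> reach_prob d q p (i # u) (i # u) + (\<Sum>k\<in>{..<d} - {i}. reach_prob d q p (k # u) (i # u))"
    by (intro add_left_mono sum_mono side)
  also have "\<dots> = (\<Sum>k<d. reach_prob d q p (k # u) (i # u))"
    using ui by (subst (2) sum.remove[of _ i]) auto
  finally have children: "1 + (real d - 1) * (up_prob * down_prob)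
      \<le> (\<Sum>k<d. reach_prob d q p (k # u) (i # u))" .
  have "q * p * down_prob\<^sup>2 + q * (1 - p) / real d * (1 + (real d - 1) * (up_prob * down_prob))
      \<le> q * p * reach_prob d q p (tl u) (i # u) +
        q * (1 - p) / real d * (\<Sum>k<d. reach_prob d q p (k # u) (i # u))"
    by (intro add_mono mult_left_mono up children) (use q p in auto)
  also have "\<dots> = reach_prob d q p u (i # u)"
    by (rule reach_prob_step[symmetric]) simp
  finally show "q * p * down_prob\<^sup>2 + q * (1 - p) / real d * (1 + (real d - 1) * (up_prob * down_prob))
      \<le> (case ui of (u, i) \<Rightarrow> reach_prob d q p u (i # u))" by (simp add: ui)
qed (use d in \<open>auto simp: tree_def\<close>)

lemma reach_prob_root: "up_prob ^ length v \<le> reach_prob d q p v []"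
proof (induction v)
  case (Cons i v)
  have "up_prob ^ length (i # v) \<le> reach_prob d q p (i # v) v * reach_prob d q p v []"
    unfolding length_Cons power_Suc
    by (intro mult_mono up_prob_le Cons.IH reach_prob_nonneg zero_le_power up_prob_nonneg)
  also have "\<dots> \<le> reach_prob d q p (i # v) []" by (rule reach_prob_mult)
  finally show ?case .
qed (simp add: reach_prob_self)

subsection \<open>Survival of the relays\<close>

text \<open>Split on the event \<open>C\<close> that the frog of \<open>tl w\<close> hits
  \<open>w\<close>. If it holds, it suffices that the frog of \<open>v\<close> hits
  \<open>tl w\<close>; otherwise that it hits \<open>w\<close>. As \<open>C\<close> concerns a
  different frog, both cases factor, and the correlation between the two hits by the frog of
  \<open>v\<close> never enters.\<close>

lemma prob_relay_ge:
  assumes v: "v \<in> tree d" and w: "w \<in> grandchildren d v"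
  shows "down_prob\<^sup>2 * (2 - down_prob) \<le> \<P>(\<omega> in FM d q p. relay \<omega> v w)"
proof -
  interpret prob_space "FM d q p" by (rule prob_space_FM)
  note [simp] = down_prob_nonneg down_prob_le_1
  note wt = grandchildren_tree[OF v w]
  from w obtain i j where ij: "i < d" "j < d" "w = j # i # v" by (rule grandchildrenE)
  define A where "A \<omega> = frog_hits \<omega> v (tl w)" for \<omega>
  define B where "B \<omega> = frog_hits \<omega> v w" for \<omega>
  define C where "C \<omega> = frog_hits \<omega> (tl w) w" for \<omega>
  have meas: "Measurable.pred (FM d q p) A" "Measurable.pred (FM d q p) B" "Measurable.pred (FM d q p) C"
    unfolding A_def B_def C_def using v wt by (auto intro: measurable_frog_hits)
  have step: "down_prob \<le> reach_prob d q p v (tl w)" "down_prob \<le> reach_prob d q p (tl w) w"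
    using ij wt v by (auto intro!: down_prob_le)
  have a: "down_prob \<le> \<P>(\<omega> in FM d q p. A \<omega>)" and c: "down_prob \<le> \<P>(\<omega> in FM d q p. C \<omega>)"
    unfolding A_def C_def
    using step reach_prob_le_prob_frog_hits v wt by (blast intro: order_trans)+
  have "down_prob\<^sup>2 \<le> reach_prob d q p v (tl w) * reach_prob d q p (tl w) w"
    unfolding power2_eq_square using step by (intro mult_mono reach_prob_nonneg) auto
  also have "\<dots> \<le> reach_prob d q p v w" by (rule reach_prob_mult)
  also have "\<dots> \<le> \<P>(\<omega> in FM d q p. B \<omega>)"
    unfolding B_def by (rule reach_prob_le_prob_frog_hits[OF v])
  finally have b: "down_prob\<^sup>2 \<le> \<P>(\<omega> in FM d q p. B \<omega>)" .
  let ?c = "\<P>(\<omega> in FM d q p. C \<omega>)"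
  have sub: "{v} \<times> UNIV \<subseteq> tree d \<times> (UNIV :: nat set)" "{tl w} \<times> UNIV \<subseteq> tree d \<times> (UNIV :: nat set)"
    "{v} \<times> UNIV \<inter> {tl w} \<times> (UNIV :: nat set) = {}"
    using v wt ij by auto
  have AC: "\<P>(\<omega> in FM d q p. A \<omega> \<and> C \<omega>) = \<P>(\<omega> in FM d q p. A \<omega>) * ?c"
    by (rule prob_FM_disjoint2[OF sub(3,1,2) meas(1,3)])
      (auto simp: A_def C_def intro!: frog_hits_cong)
  have "\<P>(\<omega> in FM d q p. B \<omega> \<and> \<not> C \<omega>) = \<P>(\<omega> in FM d q p. B \<omega>) * \<P>(\<omega> in FM d q p. \<not> C \<omega>)"
    by (rule prob_FM_disjoint2[OF sub(3,1,2) meas(2) pred_intros_logic(2)[OF meas(3)]])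
      (auto simp: B_def C_def intro!: frog_hits_cong arg_cong[where f = Not])
  also have "\<P>(\<omega> in FM d q p. \<not> C \<omega>) = 1 - ?c"
    by (rule prob_neg) (use meas(3) in \<open>simp add: pred_def\<close>)
  finally have BC: "\<P>(\<omega> in FM d q p. B \<omega> \<and> \<not> C \<omega>) = \<P>(\<omega> in FM d q p. B \<omega>) * (1 - ?c)" .
  \<comment> \<open>With y for \<open>down_prob\<close>, the bound y c + y^2 (1 - c) increases in c
    because y^2 <= y, so c may be lowered to y.\<close>
  have "0 \<le> (?c - down_prob) * (down_prob * (1 - down_prob))" using c by (intro mult_nonneg_nonneg) auto
  hence "down_prob\<^sup>2 * (2 - down_prob) \<le> down_prob * ?c + down_prob\<^sup>2 * (1 - ?c)"
    by (simp add: power2_eq_square algebra_simps)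
  also have "\<dots> \<le> \<P>(\<omega> in FM d q p. A \<omega>) * ?c + \<P>(\<omega> in FM d q p. B \<omega>) * (1 - ?c)"
    using a b by (intro add_mono mult_right_mono) auto
  also have "\<dots> = \<P>(\<omega> in FM d q p. A \<omega> \<and> C \<omega>) + \<P>(\<omega> in FM d q p. B \<omega> \<and> \<not> C \<omega>)"
    by (simp add: AC BC)
  also have "\<dots> = prob ({\<omega> \<in> space (FM d q p). A \<omega> \<and> C \<omega>} \<union> {\<omega> \<in> space (FM d q p). B \<omega> \<and> \<not> C \<omega>})"
    using pred_intros_logic(3)[OF meas(1,3)]
      pred_intros_logic(3)[OF meas(2) pred_intros_logic(2)[OF meas(3)]]
    by (intro finite_measure_Union[symmetric]) (auto simp: pred_def)
  also have "\<dots> \<le> \<P>(\<omega> in FM d q p. relay \<omega> v w)"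
    using measurable_relay[OF v w]
    by (intro finite_measure_mono) (auto simp: A_def B_def C_def relay_def pred_def)
  finally show ?thesis .
qed

text \<open>This is \<open>prob_marked_ge\<close> with grandchildren as index set, relays as marks
  and returns from the grandchildren as \<open>Y\<close>. The coefficient of \<open>x\<close> bounds
  the mean number of relayed grandchildren from below; the quadratic loss has coefficient
  \<open>real d ^ 4\<close> since there are d^2 grandchildren.\<close>

lemma prob_relays_return_step:
  assumes v: "v \<in> tree d" and x: "0 \<le> x" "x \<le> 1"
    and ret: "\<And>w. w \<in> grandchildren d v \<Longrightarrow> x \<le> \<P>(\<omega> in FM d q p. relays_return d n \<omega> w)"
  shows "x * ((real d)\<^sup>2 * (down_prob\<^sup>2 * (2 - down_prob))) - x\<^sup>2 * (real d) ^ 4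
    \<le> \<P>(\<omega> in FM d q p. relays_return d (Suc n) \<omega> v)"
proof -
  interpret prob_space "FM d q p" by (rule prob_space_FM)
  let ?W = "grandchildren d v"
  note W = finite_grandchildren[of d v]
  have mX: "Measurable.pred (FM d q p) (\<lambda>\<omega>. relay \<omega> v w)" if "w \<in> ?W" for w
    by (rule measurable_relay[OF v that])
  have mY: "Measurable.pred (FM d q p) (\<lambda>\<omega>. relays_return d n \<omega> w)" if "w \<in> ?W" for w
    by (rule measurable_relays_return) (use grandchildren_tree[OF v that] in simp)
  have ind: "\<P>(\<omega> in FM d q p. (\<forall>w\<in>?W. relay \<omega> v w \<longleftrightarrow> w \<in> S) \<and> (\<forall>w\<in>S. \<not> relays_return d n \<omega> w))
      \<le> \<P>(\<omega> in FM d q p. \<forall>w\<in>?W. relay \<omega> v w \<longleftrightarrow> w \<in> S) * (1 - x) ^ card S"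
    if S: "S \<subseteq> ?W" for S
  proof -
    \<comment> \<open>The frogs of \<open>v\<close> and its children decide all relays. The index
      \<open>None\<close> stands for the pattern of relays and \<open>Some w\<close> for the return
      from \<open>w\<close>.\<close>
    define near where "near = insert v {u \<in> subtree d v. length u = Suc (length v)}"
    define J where "J k = (case k of None \<Rightarrow> near | Some w \<Rightarrow> subtree d w) \<times> (UNIV :: nat set)" for k
    define P where "P k \<omega> = (case k of None \<Rightarrow> \<forall>w\<in>?W. relay \<omega> v w \<longleftrightarrow> w \<in> S
        | Some w \<Rightarrow> \<not> relays_return d n \<omega> w)" for k \<omega>
    let ?K = "insert None (Some ` S)"
    have finS: "finite S" using S W by (rule finite_subset)
    have near_far: "near \<inter> subtree d w = {}" if "w \<in> ?W" for w
      using length_grandchildren[OF that] length_subtree[of _ d w] by (auto simp: near_def) force+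
    have far: "subtree d w \<inter> subtree d w' = {}" if "w \<in> ?W" "w' \<in> ?W" "w \<noteq> w'" for w w'
      using disjoint_subtrees length_grandchildren that by metis
    have "\<P>(\<omega> in FM d q p. \<forall>k\<in>?K. P k \<omega>) = (\<Prod>k\<in>?K. \<P>(\<omega> in FM d q p. P k \<omega>))"
    proof (rule prob_FM_disjoint)
      show "disjoint_family_on J ?K"
        unfolding disjoint_family_on_def
      proof (intro ballI impI)
        fix k l assume kl: "k \<in> ?K" "l \<in> ?K" "k \<noteq> l"
        show "J k \<inter> J l = {}"
          using kl S near_far far unfolding J_def by (cases k; cases l) (simp_all, blast+)
      qed
      show "J k \<subseteq> tree d \<times> UNIV" if "k \<in> ?K" for k
      proof (cases k)
        case None
        thus ?thesis using v subtree_subset_tree[OF v] by (auto simp: J_def near_def)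
      next
        case (Some w)
        with that S have "w \<in> tree d" using grandchildren_tree[OF v] by auto
        thus ?thesis using subtree_subset_tree by (auto simp: Some J_def)
      qed
      show "Measurable.pred (FM d q p) (P k)" if k: "k \<in> ?K" for k
      proof (cases k)
        case None
        have "Measurable.pred (FM d q p) (\<lambda>\<omega>. \<forall>w\<in>?W. relay \<omega> v w \<longleftrightarrow> w \<in> S)"
          by (intro pred_intros_countable_bounded countable_finite W pred_intros_logic mX) auto
        thus ?thesis unfolding P_def None by simp
      next
        case (Some w)
        thus ?thesis unfolding P_def using k S mY pred_intros_logic(2) by auto
      qed
      show "P k \<omega> = P k \<omega>'" if k: "k \<in> ?K" and eq: "\<And>i. i \<in> J k \<Longrightarrow> \<omega> i = \<omega>' i" for k \<omega> \<omega>'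
      proof (cases k)
        case None
        have "relay \<omega> v w = relay \<omega>' v w" if "w \<in> ?W" for w
          by (rule relay_cong[OF that], rule eq) (auto simp: None J_def near_def)
        thus ?thesis by (simp add: P_def None)
      next
        case (Some w)
        have "relays_return d n \<omega> w = relays_return d n \<omega>' w"
          by (rule relays_return_cong, rule eq) (auto simp: Some J_def)
        thus ?thesis by (simp add: P_def Some)
      qed
    qed (use finS in auto)
    also have "\<dots> = \<P>(\<omega> in FM d q p. P None \<omega>) * (\<Prod>w\<in>S. \<P>(\<omega> in FM d q p. P (Some w) \<omega>))"
      using finS by (simp add: prod.reindex)
    also have "(\<Prod>w\<in>S. \<P>(\<omega> in FM d q p. P (Some w) \<omega>)) \<le> (\<Prod>w\<in>S. 1 - x)"
    proof (rule prod_mono)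
      fix w assume "w \<in> S"
      with S have w: "w \<in> ?W" by auto
      have "\<P>(\<omega> in FM d q p. \<not> relays_return d n \<omega> w) = 1 - \<P>(\<omega> in FM d q p. relays_return d n \<omega> w)"
        by (rule prob_neg) (use mY[OF w] in \<open>simp add: pred_def\<close>)
      with ret[OF w] show "0 \<le> \<P>(\<omega> in FM d q p. P (Some w) \<omega>) \<and> \<P>(\<omega> in FM d q p. P (Some w) \<omega>) \<le> 1 - x"
        by (simp add: P_def)
    qed
    finally have "\<P>(\<omega> in FM d q p. \<forall>k\<in>?K. P k \<omega>) \<le> \<P>(\<omega> in FM d q p. P None \<omega>) * (1 - x) ^ card S"
      by (simp add: mult_left_mono)
    thus ?thesis by (simp add: P_def)
  qed
  have "(real d)\<^sup>2 * (down_prob\<^sup>2 * (2 - down_prob)) = (\<Sum>w\<in>?W. down_prob\<^sup>2 * (2 - down_prob))"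
    by (simp add: card_grandchildren)
  also have "\<dots> \<le> (\<Sum>w\<in>?W. \<P>(\<omega> in FM d q p. relay \<omega> v w))"
    by (intro sum_mono prob_relay_ge[OF v])
  finally have "x * ((real d)\<^sup>2 * (down_prob\<^sup>2 * (2 - down_prob))) \<le> x * (\<Sum>w\<in>?W. \<P>(\<omega> in FM d q p. relay \<omega> v w))"
    using x by (intro mult_left_mono)
  moreover have "(real (card ?W))\<^sup>2 = real d ^ 4"
    by (simp add: card_grandchildren flip: power_mult)
  ultimately show ?thesis
    using prob_marked_ge[OF W x mX mY ind] by simp
qed

text \<open>Induction on \<open>n\<close> for all \<open>v\<close> at once, with lower bound
  \<open>min c (up_prob ^ length v)\<close>. Two levels further down the bound shrinks at most by
  the factor \<open>up_prob\<^sup>2\<close>, and the branching step makes up for this as long as the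
  bound stays below \<open>c\<close>.\<close>

lemma prob_relays_return_bounded_below:
  assumes r: "0 < up_prob" and branching: "1 < (real d)\<^sup>2 * (down_prob\<^sup>2 * (2 - down_prob)) * up_prob\<^sup>2"
  shows "\<exists>c>0. \<forall>n. c \<le> \<P>(\<omega> in FM d q p. relays_return d n \<omega> [])"
proof -
  let ?m = "(real d)\<^sup>2 * (down_prob\<^sup>2 * (2 - down_prob))"
  note r1 = up_prob_le_1
  \<comment> \<open>Chosen so that \<open>?m - c * real d ^ 4\<close> equals
    \<open>1 / up_prob\<^sup>2\<close>, which exactly offsets the descent by two levels.\<close>
  define c where "c = (?m - 1 / up_prob\<^sup>2) / real d ^ 4"
  have c: "0 < c" using branching r d by (simp add: c_def field_simps)
  have main: "v \<in> tree d \<Longrightarrow> min c (up_prob ^ length v) \<le> \<P>(\<omega> in FM d q p. relays_return d n \<omega> v)" for n v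
  proof (induction n arbitrary: v)
    case 0
    have "min c (up_prob ^ length v) \<le> reach_prob d q p v []"
      using reach_prob_root[of v] by linarith
    also have "\<dots> \<le> \<P>(\<omega> in FM d q p. frog_hits \<omega> v [])"
      by (rule reach_prob_le_prob_frog_hits[OF 0])
    finally show ?case by simp
  next
    case (Suc n)
    define x where "x = min c (up_prob ^ (length v + 2))"
    have x: "0 \<le> x" "x \<le> 1" "x \<le> c"
      using c r r1 power_le_one[of up_prob "length v + 2"] by (auto simp: x_def min_def)
    have r2: "0 < up_prob\<^sup>2" "up_prob\<^sup>2 \<le> 1" using r r1 by (auto simp: power_le_one)
    have "min c (up_prob ^ length v) * up_prob\<^sup>2 \<le> x"
    proof -
      have "min c (up_prob ^ length v) * up_prob\<^sup>2 \<le> c * 1" using c r2 by (intro mult_mono) auto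
      moreover have "min c (up_prob ^ length v) * up_prob\<^sup>2 \<le> up_prob ^ (length v + 2)"
        unfolding power_add using r2 by (intro mult_right_mono) auto
      ultimately show ?thesis unfolding x_def mult_1_right by (rule min.boundedI)
    qed
    hence "min c (up_prob ^ length v) \<le> x * (1 / up_prob\<^sup>2)" using r2 by (simp add: field_simps)
    also have "1 / up_prob\<^sup>2 = ?m - c * real d ^ 4" using d by (simp add: c_def)
    also have "x * (?m - c * real d ^ 4) \<le> x * (?m - x * real d ^ 4)"
      using x by (intro mult_left_mono diff_left_mono mult_right_mono) auto
    also have "\<dots> = x * ?m - x\<^sup>2 * real d ^ 4" by (simp add: power2_eq_square algebra_simps)
    also have "\<dots> \<le> \<P>(\<omega> in FM d q p. relays_return d (Suc n) \<omega> v)"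
    proof (rule prob_relays_return_step[OF Suc.prems x(1,2)])
      fix w assume w: "w \<in> grandchildren d v"
      show "x \<le> \<P>(\<omega> in FM d q p. relays_return d n \<omega> w)"
        using Suc.IH[of w] grandchildren_tree[OF Suc.prems w]
        unfolding length_grandchildren[OF w] x_def by blast
    qed
    finally show ?case .
  qed
  have "[] \<in> tree d" by (simp add: tree_def)
  from main[OF this] show ?thesis using c by (intro exI[of _ "min c 1"]) auto
qed

text \<open>By continuity from above, events of probability at least \<open>c\<close> occur
  infinitely often with probability at least \<open>c\<close>. Then frogs from unboundedly many
  levels visit the root.\<close>

lemma recurrence_prob_pos:
  assumes "0 < up_prob" and "1 < (real d)\<^sup>2 * (down_prob\<^sup>2 * (2 - down_prob)) * up_prob\<^sup>2"
  shows "0 < recurrence_prob d q p"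
proof -
  interpret prob_space "FM d q p" by (rule prob_space_FM)
  obtain c where c: "0 < c" "\<And>n. c \<le> \<P>(\<omega> in FM d q p. relays_return d n \<omega> [])"
    using prob_relays_return_bounded_below[OF assms] by blast
  have root: "[] \<in> tree d" by (simp add: tree_def)
  define E where "E n = {\<omega> \<in> space (FM d q p). relays_return d n \<omega> []}" for n
  define A where "A N = (\<Union>n\<in>{N..}. E n)" for N
  have E: "E n \<in> events" for n
    using measurable_relays_return[OF root] by (simp add: E_def pred_def)
  hence A: "A N \<in> events" for N by (auto simp: A_def)
  have "decseq A" unfolding A_def decseq_def by (intro allI impI UN_mono) auto
  hence "(\<lambda>N. prob (A N)) \<longlonglongrightarrow> prob (\<Inter>N. A N)"
    using A by (intro finite_Lim_measure_decseq) auto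
  moreover have "c \<le> prob (A N)" for N
  proof -
    have "c \<le> prob (E N)" using c(2) by (simp add: E_def)
    also have "\<dots> \<le> prob (A N)" by (rule finite_measure_mono) (use A in \<open>auto simp: A_def\<close>)
    finally show ?thesis .
  qed
  ultimately have "c \<le> prob (\<Inter>N. A N)" by (intro LIMSEQ_le_const) auto
  also have "\<dots> \<le> recurrence_prob d q p"
    unfolding recurrence_prob_def
  proof (rule finite_measure_mono[OF _ sets_recurrent], rule subsetI)
    fix \<omega> assume \<omega>: "\<omega> \<in> (\<Inter>N. A N)"
    let ?F = "{v \<in> tree d. \<exists>t k. config d \<omega> t v = Active [] k}"
    have "infinite ?F"
    proof
      assume "finite ?F"
      then obtain L where L: "\<And>v. v \<in> ?F \<Longrightarrow> length v < L"
        using finite_nat_set_iff_bounded[of "length ` ?F"] by auto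
      from \<omega> obtain n where n: "L \<le> n" "relays_return d n \<omega> []" by (auto simp: A_def E_def)
      have "activated d \<omega> []" unfolding activated_def by (rule exI[of _ 0]) simp
      from relays_return_activated[OF this root n(2)] obtain u
        where u: "u \<in> tree d" "length u = 2 * n" "activated d \<omega> u" "frog_hits \<omega> u []" by auto
      from activated_frog_visits[OF u(3,4)] u(1) have "u \<in> ?F" by auto
      from L[OF this] u(2) n(1) show False by simp
    qed
    moreover have "\<omega> \<in> space (FM d q p)" using \<omega> by (auto simp: A_def E_def)
    ultimately show "\<omega> \<in> {\<omega> \<in> space (FM d q p). recurrent d \<omega>}" by (simp add: recurrent_def)
  qed
  finally show ?thesis using c(1) by linarith
qed

end

subsection \<open>Drift \<open>1 / 2\<close>\<close>

text \<open>The last hypothesis says (1 - r)^2 <= (1 - q) (1 + r^2). The right side is at most 4e-7,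
  below 0.001^2.\<close>

lemma near_one_if_ge_half_quadratic:
  fixes r q :: real
  assumes "0.9999998 \<le> q" "q \<le> 1" "0 \<le> r" "r \<le> 1" "q * (1 + r\<^sup>2) \<le> 2 * r"
  shows "0.999 \<le> r"
proof (rule ccontr)
  assume "\<not> 0.999 \<le> r"
  hence "(1 / 1000)\<^sup>2 < (1 - r)\<^sup>2" by (intro power_strict_mono) auto
  moreover have "0.9999998 * (1 + r\<^sup>2) \<le> q * (1 + r\<^sup>2)" using assms by (intro mult_right_mono) auto
  moreover have "r\<^sup>2 \<le> 1" using assms by (simp add: power_le_one)
  ultimately show False using assms(5) by (simp add: power2_eq_square algebra_simps)
qed

text \<open>For \<open>q = r = 1\<close> the quadratic inequality reads \<open>(y d - 1) (y - 1) \<le> 0\<close>.\<close>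

lemma down_quadratic:
  fixes y r q D :: real
  assumes "2 \<le> D" "0.999 \<le> q" "q \<le> 1" "0.999 \<le> r" "r \<le> 1" "0 \<le> y" "y \<le> 1"
    and le: "q / 2 * y\<^sup>2 + q / 2 / D * (1 + (D - 1) * (r * y)) \<le> y"
  shows "0.95 \<le> D * y"
proof (rule ccontr)
  assume "\<not> 0.95 \<le> D * y"
  hence z: "D * y < 0.95" by simp
  \<comment> \<open>0.999^2 = 0.998001, rounded down.\<close>
  have qr: "(499 / 500) \<le> q * r" using mult_mono[of "0.999" q "0.999" r] assms by simp
  have "q * (D * y\<^sup>2 + 1 + (D - 1) * (r * y)) \<le> 2 * (D * y)"
  proof -
    have "q * (D * y\<^sup>2 + 1 + (D - 1) * (r * y)) =
        2 * D * (q / 2 * y\<^sup>2 + q / 2 / D * (1 + (D - 1) * (r * y)))"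
      using assms(1) by (simp add: divide_simps) (simp add: algebra_simps)
    also have "\<dots> \<le> 2 * D * y" using le assms(1) by (intro mult_left_mono) auto
    finally show ?thesis by simp
  qed
  moreover have "(499 / 500) * (D * y\<^sup>2 + 1 + (D - 1) * y) \<le> (q * r) * (D * y\<^sup>2 + 1 + (D - 1) * y)"
    using assms qr by (intro mult_right_mono add_nonneg_nonneg mult_nonneg_nonneg) auto
  moreover have "r * (D * y\<^sup>2 + 1 + (D - 1) * y) \<le> D * y\<^sup>2 + 1 + (D - 1) * (r * y)"
  proof -
    have "r * (D * y\<^sup>2 + 1) \<le> 1 * (D * y\<^sup>2 + 1)" using assms by (intro mult_right_mono) auto
    thus ?thesis by (simp add: algebra_simps)
  qed
  hence "q * (r * (D * y\<^sup>2 + 1 + (D - 1) * y)) \<le> q * (D * y\<^sup>2 + 1 + (D - 1) * (r * y))"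
    using assms by (intro mult_left_mono) auto
  ultimately have main: "(499 / 500) * (D * y\<^sup>2 + 1 + (D - 1) * y) \<le> 2 * (D * y)" by simp
  define z where "z = D * y"
  have z01: "0 \<le> z" "z < 0.95" using assms z by (auto simp: z_def)
  \<comment> \<open>Here \<open>2 \<le> D\<close> enters: it gives 2 y <= z, which bounds y (1 - z)
    in terms of z alone.\<close>
  have "(D - 2) * (y * (1 - z)) \<ge> 0" using assms z01 by (intro mult_nonneg_nonneg) auto
  hence "2 * (y * (1 - z)) \<le> z * (1 - z)" by (simp add: z_def algebra_simps)
  define t where "t = y - z * y"
  have "2 * t \<le> z - z\<^sup>2"
    using \<open>2 * (y * (1 - z)) \<le> z * (1 - z)\<close> by (simp add: t_def power2_eq_square algebra_simps)
  moreover have "D * y\<^sup>2 + 1 + (D - 1) * y = 1 + z - t"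
    by (simp add: z_def t_def power2_eq_square algebra_simps)
  with main have "(499 / 500) * (1 + z - t) \<le> 2 * z" by (simp only: z_def)
  hence "499 + 499 * z - 499 * t \<le> 1000 * z" by (simp add: field_simps)
  ultimately have "998 + 499 * z + 499 * z\<^sup>2 \<le> 2000 * z" by linarith
  \<comment> \<open>The previous line says 499 z^2 - 1501 z + 998 <= 0. That polynomial is 499 times
    this product plus 73.6025 - 53.9 z, and both parts are positive for z < 0.95.\<close>
  moreover have "0 < (0.95 - z) * (1.95 - z)" using z01 by (intro mult_pos_pos) auto
  ultimately show False using z01 by (simp add: power2_eq_square algebra_simps)
qed

text \<open>The map y^2 (2 - y) increases on [0,1], so \<open>y\<close> may be lowered to
  \<open>a = 0.95 / D\<close>. As \<open>a\<close> is at most 0.475, what remains is at least 0.95^2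
  times 1.5 times 0.999^2, which exceeds 1.\<close>

lemma branching_constant:
  fixes y r D :: real
  assumes "2 \<le> D" "0.999 \<le> r" "0 \<le> y" "y \<le> 1" "0.95 \<le> D * y"
  shows "1 < D\<^sup>2 * (y\<^sup>2 * (2 - y)) * r\<^sup>2"
proof -
  define a where "a = 0.95 / D"
  have a: "0 \<le> a" "a \<le> y" "a \<le> 0.475" "D * a = 0.95" using assms by (auto simp: a_def field_simps)
  \<comment> \<open>The product is the difference of y^2 (2 - y) and a^2 (2 - a), with the cofactor
    of y - a written as a sum of nonnegative terms.\<close>
  have "0 \<le> (y - a) * (y * (1 - y) + a * (1 - a) + y * (1 - a) + a)"
    using assms a by (intro mult_nonneg_nonneg add_nonneg_nonneg) auto
  hence "a\<^sup>2 * (2 - a) \<le> y\<^sup>2 * (2 - y)" by (simp add: power2_eq_square algebra_simps)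
  hence "D\<^sup>2 * (a\<^sup>2 * (2 - a)) \<le> D\<^sup>2 * (y\<^sup>2 * (2 - y))" by (intro mult_left_mono) auto
  moreover have "D\<^sup>2 * (a\<^sup>2 * (2 - a)) = (D * a)\<^sup>2 * (2 - a)" by (simp add: power_mult_distrib)
  moreover have "(D * a)\<^sup>2 * (2 - a) \<ge> 0.95\<^sup>2 * 1.5" unfolding a(4) using a(3) by (simp add: power2_eq_square)
  moreover have "0.999\<^sup>2 \<le> r\<^sup>2" using assms by (intro power_mono) auto
  moreover have "(1.3 :: real) \<le> 0.95\<^sup>2 * 1.5" "(0.99 :: real) \<le> 0.999\<^sup>2"
    by (simp_all add: power2_eq_square)
  ultimately have "1.3 \<le> D\<^sup>2 * (y\<^sup>2 * (2 - y))" "0.99 \<le> r\<^sup>2" by linarith+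
  hence "1.3 * 0.99 \<le> D\<^sup>2 * (y\<^sup>2 * (2 - y)) * r\<^sup>2" by (intro mult_mono) auto
  thus ?thesis by simp
qed

lemma recurrence_prob_half_pos:
  assumes d: "2 \<le> d" and q: "0.9999998 \<le> q" "q \<le> 1"
  shows "0 < recurrence_prob d q (1 / 2)"
proof -
  have c: "d > 0" "0 \<le> q" "q \<le> 1" "0 \<le> (1 / 2 :: real)" "(1 / 2 :: real) \<le> 1" using d q by auto
  let ?r = "up_prob d q (1 / 2)" and ?y = "down_prob d q (1 / 2)"
  note y = down_prob_nonneg[OF c] down_prob_le_1[OF c]
  have "q * (1 + ?r\<^sup>2) \<le> 2 * ?r" using up_prob_ge[OF c] by (simp add: algebra_simps)
  hence r: "0.999 \<le> ?r"
    using q up_prob_nonneg[OF c] up_prob_le_1[OF c] by (intro near_one_if_ge_half_quadratic[of q])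
  have "0.95 \<le> real d * ?y"
  proof (rule down_quadratic[of _ q ?r])
    show "q / 2 * ?y\<^sup>2 + q / 2 / real d * (1 + (real d - 1) * (?r * ?y)) \<le> ?y"
      using down_prob_ge[OF c] by simp
  qed (use d q r y up_prob_le_1[OF c] in auto)
  from branching_constant[OF _ r y this] d show ?thesis
    using r by (intro recurrence_prob_pos[OF c]) auto
qed

subsection \<open>Drift \<open>0\<close> and \<open>1\<close>\<close>

lemma recurrence_prob_eq_0:
  assumes "AE \<omega> in FM d q p. \<forall>v\<in>tree d. \<forall>t k. config d \<omega> t v = Active [] k \<longrightarrow> v = []"
  shows "recurrence_prob d q p = 0"
proof -
  have "AE \<omega> in FM d q p. \<not> recurrent d \<omega>"
    using assms
  proof eventually_elim
    case (elim \<omega>)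
    hence "{v \<in> tree d. \<exists>t k. config d \<omega> t v = Active [] k} \<subseteq> {[]}" by auto
    thus ?case unfolding recurrent_def using finite_subset by blast
  qed
  from emeasure_eq_0_AE[OF this] show ?thesis
    by (simp add: recurrence_prob_def measure_def)
qed

text \<open>Almost surely no \<open>Up\<close> occurs, so no frog is ever at a smaller depth than
  the one at which it started.\<close>

lemma recurrence_prob_0:
  assumes "0 \<le> q" "q \<le> 1" "d > 0"
  shows "recurrence_prob d q 0 = 0"
proof (rule recurrence_prob_eq_0)
  have "pmf (action_pmf d q 0) Up = 0" using assms by (simp add: pmf_action)
  from AE_FM_action[OF this]
  show "AE \<omega> in FM d q 0. \<forall>v\<in>tree d. \<forall>t k. config d \<omega> t v = Active [] k \<longrightarrow> v = []"
  proof eventually_elim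
    case (elim \<omega>)
    have "config d \<omega> t v = Active x k \<Longrightarrow> length v \<le> length x" if v: "v \<in> tree d" for v t x k
    proof (induction t arbitrary: x k)
      case (Suc t)
      show ?case
      proof (cases "config d \<omega> t v")
        case (Active x' k')
        with Suc.prems elim v Suc.IH[OF Active] show ?thesis by (auto split: action.splits)
      qed (use Suc.prems in \<open>auto split: if_splits\<close>)
    qed (auto split: if_splits)
    thus ?case by fastforce
  qed
qed

text \<open>Almost surely no \<open>Down\<close> occurs, so the first frog stays at the root and
  wakes nobody. The induction over time treats all frogs together, since waking depends on the
  positions of the others.\<close>

lemma recurrence_prob_1:
  assumes "0 \<le> q" "q \<le> 1" "d > 0"
  shows "recurrence_prob d q 1 = 0"
proof (rule recurrence_prob_eq_0)
  have "pmf (action_pmf d q 1) (Down i) = 0" for i using assms by (simp add: pmf_action)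
  from AE_FM_action[OF this]
  have "AE \<omega> in FM d q 1. \<forall>i. \<forall>v\<in>tree d. \<forall>k. \<omega> (v, k) \<noteq> Down i"
    unfolding AE_all_countable ..
  thus "AE \<omega> in FM d q 1. \<forall>v\<in>tree d. \<forall>t k. config d \<omega> t v = Active [] k \<longrightarrow> v = []"
  proof eventually_elim
    case (elim \<omega>)
    have adv: "v = [] \<and> x = []"
      if "advance (\<lambda>j. \<omega> (v, j)) s = Active x k" "v \<in> tree d" "\<And>y l. s = Active y l \<Longrightarrow> v = [] \<and> y = []"
      for v x k s
      using that elim by (cases s) (auto split: action.splits)
    have "v \<in> tree d \<Longrightarrow> config d \<omega> t v = Active x k \<Longrightarrow> v = [] \<and> x = []" for v t x k
    proof (induction t arbitrary: v x k)
      case (Suc t)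
      show ?case
      proof (cases "config d \<omega> t v = Asleep")
        case True
        with Suc.prems obtain w l where w: "w \<in> tree d" "x = v"
          "advance (\<lambda>j. \<omega> (w, j)) (config d \<omega> t w) = Active v l"
          by (auto split: if_splits)
        have "w = [] \<and> v = []" by (rule adv[OF w(3,1)]) (rule Suc.IH[OF w(1)])
        with w(2) show ?thesis by blast
      next
        case False
        with Suc.prems(2) have "advance (\<lambda>j. \<omega> (v, j)) (config d \<omega> t v) = Active x k" by simp
        from adv[OF this Suc.prems(1) Suc.IH[OF Suc.prems(1)]] show ?thesis .
      qed
    qed (auto split: if_splits)
    thus ?case by blast
  qed
qed

theorem corollary3:
  fixes d :: nat and q :: real
  assumes "d \<ge> 2" and "0.9999998 \<le> q" and "q < 1"
  shows "\<not> mono_on {0..1} (recurrence_prob d q) \<and> \<not> antimono_on {0..1} (recurrence_prob d q)"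
proof -
  have pos: "0 < recurrence_prob d q (1 / 2)"
    using assms by (intro recurrence_prob_half_pos) auto
  have zero: "recurrence_prob d q 0 = 0" "recurrence_prob d q 1 = 0"
    using assms by (auto intro: recurrence_prob_0 recurrence_prob_1)
  \<comment> \<open>Monotonicity fails between 1/2 and 1, antimonotonicity between 0 and
    1/2.\<close>
  show ?thesis
    using pos zero monotone_onD[of "{0..1}" "(\<le>)" "(\<le>)" "recurrence_prob d q" "1 / 2" 1]
      monotone_onD[of "{0..1}" "(\<le>)" "(\<ge>)" "recurrence_prob d q" 0 "1 / 2"]
    by auto
qed

end
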